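(* Let $N\ge1$ be an integer and let $g:\mathbb{R}^n\times\mathbb{N}_0^n\times\mathbb{N}_0^n\to\mathbb{C}$ be a $C^N$ function in the first variable such that $|\partial_x^\gamma g(x,\xi,\eta)\,h_\xi(x)|\to0$ as $|x|\to\infty$ for all $|\gamma|\le N$ and $(\xi,\eta)\in\mathbb{N}_0^{2n}$. Set $$G(\xi,\eta):=\int g(x,\xi,\eta)\,h_\xi(x)\,h_\eta(x)\,dx .$$ Then for each $i\in\{1,\dots,n\}$, $$2^N(\xi_i-\eta_i)^N\,G(\xi,\eta)=\sum_{\substack{-N\le\alpha,\beta\le N,\\ 1\le\ell\le N,\\ |\alpha-\beta|\le N}}C(N,\xi_i,\eta_i,\alpha,\beta)\int\partial_i^\ell g(x,\xi,\eta)\,h_{\xi+\alpha e_i}(x)\,h_{\eta+\beta e_i}(x)\,dx,$$ where $C(N,\xi_i,\eta_i,\alpha,\beta)$ are constants satisfying $$|C(N,\xi_i,\eta_i,\alpha,\beta)|\le c_N\,\langle\xi_i\vee\eta_i\rangle^{N/2},$$ and the sum contains at most $5^N$ terms.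
   Context: $\mathbb{N}_0=\{0,1,2,\dots\}$; $e_i$ is the $i$-th standard basis vector; $\partial_i=\partial/\partial x_i$; $\gamma$ denotes a multi-index in $\mathbb{N}_0^n$; $\langle t\rangle=1+|t|$; $a\vee b=\max(a,b)$; integrals are over $\mathbb{R}^n$. Hermite functions: for $k\in\mathbb{N}_0$, $H_k(t)=(-1)^k e^{t^2}\partial_t^k(e^{-t^2})$ and $h_k(t)=(2^kk!\sqrt{\pi})^{-1/2}H_k(t)e^{-t^2/2}$, $t\in\mathbb{R}$; for $\xi\in\mathbb{N}_0^n$, $h_\xi(x)=\prod_{j=1}^n h_{\xi_j}(x_j)$, $x\in\mathbb{R}^n$. By convention $h_\zeta=0$ if $\zeta\in\mathbb{Z}^n$ has a negative entry.
   Formalization: The constants C may also depend on ℓ: without this the claim fails (n=1, N=2, g=e^{-x}, ξ=0, η=1, where g'+g''=0). "At most 5^N terms" counts nonzero constants, and integrals on the right may converge only conditionally (Henstock–Kurzweil). *)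

theory Defs
  imports "HOL-Analysis.Analysis"
begin

definition Hermite_poly :: "nat \<Rightarrow> real \<Rightarrow> real" where
  "Hermite_poly k t = (-1) ^ k * exp (t\<^sup>2) * (deriv ^^ k) (\<lambda>s. exp (- s\<^sup>2)) t"

definition hermite_fun :: "nat \<Rightarrow> real \<Rightarrow> real" where
  "hermite_fun k t =
     (2 ^ k * fact k * sqrt pi) powr (-1/2) * Hermite_poly k t * exp (- t\<^sup>2 / 2)"

definition hermite :: "nat ^ 'n \<Rightarrow> real ^ 'n \<Rightarrow> real" where
  "hermite \<xi> x = (\<Prod>j\<in>UNIV. hermite_fun (\<xi> $ j) (x $ j))"

definition hermite_int :: "int ^ 'n \<Rightarrow> real ^ 'n \<Rightarrow> real" where
  "hermite_int \<zeta> x = (if \<exists>j. \<zeta> $ j < 0 then 0 else hermite (\<chi> j. nat (\<zeta> $ j)) x)"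

definition shift :: "nat ^ 'n \<Rightarrow> int \<Rightarrow> 'n \<Rightarrow> int ^ 'n" where
  "shift \<xi> \<alpha> i = (\<chi> j. int (\<xi> $ j)) + axis i \<alpha>"

definition bracket :: "real \<Rightarrow> real" where
  "bracket t = 1 + \<bar>t\<bar>"

definition partial_differentiable :: "'n \<Rightarrow> (real ^ 'n \<Rightarrow> complex) \<Rightarrow> bool" where
  "partial_differentiable i f \<longleftrightarrow>
     (\<forall>x. (\<lambda>t. f (x + t *\<^sub>R axis i 1)) differentiable (at (0::real)))"

definition partial :: "'n \<Rightarrow> (real ^ 'n \<Rightarrow> complex) \<Rightarrow> real ^ 'n \<Rightarrow> complex" where
  "partial i f x = vector_derivative (\<lambda>t. f (x + t *\<^sub>R axis i 1)) (at (0::real))"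

primrec C_class :: "nat \<Rightarrow> (real ^ 'n \<Rightarrow> complex) \<Rightarrow> bool" where
  "C_class 0 f \<longleftrightarrow> continuous_on UNIV f"
| "C_class (Suc k) f \<longleftrightarrow> continuous_on UNIV f \<and>
     (\<forall>i. partial_differentiable i f \<and> C_class k (partial i f))"

definition multi_order :: "nat ^ 'n \<Rightarrow> nat" where
  "multi_order \<gamma> = (\<Sum>j\<in>UNIV. \<gamma> $ j)"

text \<open>The order in which the partial derivatives are taken is an arbitrary one in which
  each index \<open>j\<close> occurs \<open>\<gamma> $ j\<close> times; for functions of class \<open>C_class (multi_order \<gamma>)\<close> the
  result does not depend on it.\<close>

definition multi_partial :: "nat ^ 'n \<Rightarrow> (real ^ 'n \<Rightarrow> complex) \<Rightarrow> real ^ 'n \<Rightarrow> complex" where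
  "multi_partial \<gamma> f = foldr partial (SOME js. \<forall>j. count_list js j = \<gamma> $ j) f"

text \<open>Integrals over \<open>\<real>\<^sup>n\<close> are Henstock-Kurzweil integrals (\<open>integral UNIV\<close>), which agree with
  Lebesgue integrals whenever the latter exist. The wider notion matters only for the terms
  with derivatives of \<open>g\<close>: for \<open>n \<ge> 2\<close>, decay of \<open>\<partial>\<^sup>\<gamma> g\<close> times \<open>h\<^sub>\<xi>\<close> gives no control on the zero
  set of \<open>h\<^sub>\<xi>\<close>, and there those integrals may converge only conditionally.\<close>

definition G_int :: "(real ^ 'n \<Rightarrow> nat ^ 'n \<Rightarrow> nat ^ 'n \<Rightarrow> complex) \<Rightarrow> nat ^ 'n \<Rightarrow> nat ^ 'n \<Rightarrow> complex" where
  "G_int g \<xi> \<eta> =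
     integral UNIV (\<lambda>x. g x \<xi> \<eta> * of_real (hermite \<xi> x) * of_real (hermite \<eta> x))"

definition term_integrand ::
  "(real ^ 'n \<Rightarrow> nat ^ 'n \<Rightarrow> nat ^ 'n \<Rightarrow> complex) \<Rightarrow> 'n \<Rightarrow> nat ^ 'n \<Rightarrow> nat ^ 'n \<Rightarrow>
     int \<Rightarrow> int \<Rightarrow> nat \<Rightarrow> real ^ 'n \<Rightarrow> complex" where
  "term_integrand g i \<xi> \<eta> \<alpha> \<beta> l x =
     (partial i ^^ l) (\<lambda>y. g y \<xi> \<eta>) x *
       of_real (hermite_int (shift \<xi> \<alpha> i) x) * of_real (hermite_int (shift \<eta> \<beta> i) x)"

definition sum_index :: "nat \<Rightarrow> (int \<times> int \<times> nat) set" where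
  "sum_index N = {(\<alpha>, \<beta>, l). - int N \<le> \<alpha> \<and> \<alpha> \<le> int N \<and> - int N \<le> \<beta> \<and> \<beta> \<le> int N \<and>
     1 \<le> l \<and> l \<le> N \<and> \<bar>\<alpha> - \<beta>\<bar> \<le> int N}"

end

theory Submission
  imports Defs "HOL-Computational_Algebra.Polynomial" "HOL-Probability.Distributions"
begin

text \<open>
  Let \<open>h\<^sub>k\<close> be the Hermite functions on the line, with \<open>h\<^sub>k =
  0\<close> for \<open>k < 0\<close>. By Hermite's equation \<open>h\<^sub>k'' = (t\<^sup>2 - 2 k
  - 1) h\<^sub>k\<close> the Wronskian \<open>W = h\<^sub>m' h\<^sub>n - h\<^sub>m
  h\<^sub>n'\<close> satisfies \<open>W' = 2 (n - m) h\<^sub>m h\<^sub>n\<close>, so integrating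
  by parts in \<open>x\<^sub>i\<close> gives \<open>2 (m - n) \<integral> f h\<^sub>m h\<^sub>n =
  \<integral> \<partial>\<^sub>i f W\<close>. Since \<open>h\<^sub>k' = sqrt (k / 2) h\<^bsub>k -
  1\<^esub> - sqrt ((k + 1) / 2) h\<^bsub>k + 1\<^esub>\<close>, the function \<open>W\<close> is
  a combination of four products in which one of the two indices has moved by one (lemma
  \<open>pairing_recurrence\<close>).

  To iterate this, the factor is kept equal to \<open>2 (\<xi>\<^sub>i - \<eta>\<^sub>i)\<close>.
  On a term whose indices are shifted by \<open>\<alpha>\<close> and \<open>\<beta>\<close> it is
  \<open>2 ((\<xi>\<^sub>i + \<alpha>) - (\<eta>\<^sub>i + \<beta>)) + 2 (\<beta> -
  \<alpha>)\<close>. Multiplying the term by it therefore yields the same term with weight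
  \<open>2 (\<beta> - \<alpha>)\<close> and four neighbouring terms with one more derivative. Thus
  the constants of the theorem are the path sums of a weighted walk on the triples
  \<open>(\<alpha>, \<beta>, l)\<close> with five possible moves: at most \<open>5 ^ N\<close> of
  them are nonzero (\<open>card_walk_supp\<close>), and they grow at most like the
  \<open>N\<close>-th power of the largest weight, which is of the order of the square root of
  \<open>1 + max \<xi>\<^sub>i \<eta>\<^sub>i\<close> (\<open>abs_hermite_coeff_le\<close>).

  The delicate point is the convergence of the integrals. The hypothesis controls
  \<open>\<partial>\<^sub>i\<^sup>l g\<close> only after multiplication by
  \<open>h\<^sub>\<xi>\<close>, whereas the terms contain \<open>h\<^sub>\<xi>\<close> with a
  shifted index, which does not vanish on the hyperplanes where \<open>x\<^sub>i\<close> is a zero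
  of the \<open>\<xi>\<^sub>i\<close>-th Hermite polynomial \<open>p\<close>. Two ideas resolve
  this. First, the integral of a derivative \<open>\<partial>\<^sub>i F\<close> over a box only
  involves the two faces orthogonal to the \<open>i\<close>-th axis. On the faces of a large box
  \<open>\<bar>x\<^sub>i\<bar>\<close> is large, so that \<open>p\<close> is bounded away from
  zero there and \<open>\<partial>\<^sub>i F\<close> has integral zero over the whole space
  (\<open>has_integral_weighted_derivative\<close>). Secondly, \<open>p\<close> and
  \<open>p'\<close> are coprime. Hence a term with an arbitrary polynomial factor in
  \<open>x\<^sub>i\<close> is a sum of terms with the factor \<open>p\<close>, which converge
  absolutely, and of terms with a factor \<open>q p'\<close>, which become such terms after one
  integration by parts (\<open>integrable_weighted\<close>).
\<close>

section \<open>Hermite polynomials\<close>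

primrec herm_poly :: "nat \<Rightarrow> real poly" where
  "herm_poly 0 = 1"
| "herm_poly (Suc k) = [:0, 2:] * herm_poly k - pderiv (herm_poly k)"

lemma has_real_derivative_poly_gauss:
  "((\<lambda>t. poly p t * exp (- (c * t\<^sup>2))) has_real_derivative
     poly (pderiv p - smult (2 * c) ([:0, 1:] * p)) t * exp (- (c * t\<^sup>2))) (at t)"
  by (auto intro!: derivative_eq_intros simp: algebra_simps)

lemma higher_deriv_gauss:
  "(deriv ^^ k) (\<lambda>s::real. exp (- s\<^sup>2)) = (\<lambda>t. (-1) ^ k * (poly (herm_poly k) t * exp (- t\<^sup>2)))"
proof (induction k)
  case 0
  then show ?case by simp
next
  case (Suc k)
  have "deriv (\<lambda>t. (-1) ^ k * (poly (herm_poly k) t * exp (- t\<^sup>2))) t =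
      (-1) ^ Suc k * (poly (herm_poly (Suc k)) t * exp (- t\<^sup>2))" for t :: real
    using DERIV_imp_deriv[OF DERIV_cmult[OF has_real_derivative_poly_gauss[of "herm_poly k" 1 t],
      of "(-1) ^ k"]] by (simp add: algebra_simps)
  then show ?case by (simp add: Suc.IH fun_eq_iff)
qed

lemma Hermite_poly_eq: "Hermite_poly k t = poly (herm_poly k) t"
proof -
  have "(-1::real) ^ k * (-1) ^ k = 1" by (simp flip: power_mult_distrib)
  moreover have "exp (t\<^sup>2) * exp (- t\<^sup>2) = (1::real)" by (simp flip: exp_add)
  ultimately have "((-1) ^ k * (-1) ^ k) * (exp (t\<^sup>2) * exp (- t\<^sup>2)) * poly (herm_poly k) t = poly (herm_poly k) t"
    by simp
  then show ?thesis unfolding Hermite_poly_def higher_deriv_gauss by (simp only: mult_ac)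
qed

text \<open>Differentiating the recursion for \<open>k + 2\<close> and applying the induction
  hypothesis to the derivatives of the polynomial with index \<open>k + 1\<close> reproduces the
  recursion for \<open>k + 1\<close>.\<close>
lemma pderiv_herm_Suc: "pderiv (herm_poly (Suc k)) = smult (2 * real (Suc k)) (herm_poly k)"
proof (induction k)
  case 0
  then show ?case by (simp add: pderiv_pCons)
next
  case (Suc k)
  have "pderiv (herm_poly (Suc (Suc k))) =
      smult 2 (herm_poly (Suc k)) + [:0, 2:] * pderiv (herm_poly (Suc k)) - pderiv (pderiv (herm_poly (Suc k)))"
    by (subst herm_poly.simps(2))
       (simp add: pderiv_mult pderiv_diff pderiv_pCons pderiv_smult del: herm_poly.simps)
  also have "\<dots> = smult 2 (herm_poly (Suc k)) + smult (2 * real (Suc k)) (herm_poly (Suc k))"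
    by (simp only: Suc.IH pderiv_smult)
       (simp add: smult_diff_right)
  also have "\<dots> = smult (2 * real (Suc (Suc k))) (herm_poly (Suc k))"
    by (simp only: smult_add_left[symmetric]) (simp add: algebra_simps)
  finally show ?case .
qed

text \<open>Consecutive Hermite polynomials are coprime, because the three-term recurrence runs
  the Euclidean algorithm down to the constant \<open>1\<close>; the derivative is a multiple of
  the previous polynomial. In other words, all zeros are simple.\<close>
lemma herm_bezout: "\<exists>a b. herm_poly k * a + pderiv (herm_poly k) * b = 1"
proof -
  have "\<exists>a b. herm_poly k * a + herm_poly (Suc k) * b = 1"
  proof (induction k)
    case 0
    show ?case by (intro exI[of _ 1] exI[of _ 0]) simp
  next
    case (Suc k)
    then obtain a b where ab: "herm_poly k * a + herm_poly (Suc k) * b = 1" by blast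
    define c where "c = 1 / (2 * real (Suc k))"
    have "smult (2 * real (Suc k)) (herm_poly k) = [:0, 2:] * herm_poly (Suc k) - herm_poly (Suc (Suc k))"
      by (simp only: herm_poly.simps(2)[of "Suc k"] pderiv_herm_Suc diff_diff_eq2 add_diff_cancel_left')
    then have "smult c (smult (2 * real (Suc k)) (herm_poly k)) =
        smult c ([:0, 2:] * herm_poly (Suc k) - herm_poly (Suc (Suc k)))" by (rule arg_cong)
    then have "herm_poly k = smult c ([:0, 2:] * herm_poly (Suc k) - herm_poly (Suc (Suc k)))"
      by (simp add: c_def del: herm_poly.simps of_nat_Suc)
    then have "(smult c ([:0, 2:] * herm_poly (Suc k) - herm_poly (Suc (Suc k)))) * a + herm_poly (Suc k) * b = 1"
      using ab by simp
    then have "herm_poly (Suc k) * (smult c [:0, 2:] * a + b) + herm_poly (Suc (Suc k)) * (- smult c a) = 1"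
      by (simp add: algebra_simps smult_diff_right del: herm_poly.simps)
    then show ?case by blast
  qed
  then obtain a b where "herm_poly k * a + herm_poly (Suc k) * b = 1" by blast
  then have "herm_poly k * (a + [:0, 2:] * b) + pderiv (herm_poly k) * (- b) = 1"
    by (simp add: algebra_simps)
  then show ?thesis by blast
qed

section \<open>Hermite functions and their Wronskians\<close>

definition hermite_norm :: "nat \<Rightarrow> real" where
  "hermite_norm k = (2 ^ k * fact k * sqrt pi) powr (- 1 / 2)"

lemma hermite_norm_pos: "hermite_norm k > 0"
  by (simp add: hermite_norm_def)

lemma hermite_norm_Suc: "hermite_norm k = sqrt (2 * real (Suc k)) * hermite_norm (Suc k)"
proof -
  have "(2 ^ Suc k * fact (Suc k) * sqrt pi) = (2 * real (Suc k)) * (2 ^ k * fact k * sqrt pi)"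
    by (simp add: algebra_simps)
  then have "hermite_norm (Suc k) = (2 * real (Suc k)) powr (- 1 / 2) * hermite_norm k"
    unfolding hermite_norm_def by (simp only:) (rule powr_mult)
  moreover have "(2 * real (Suc k)) powr (- 1 / 2) = inverse (sqrt (2 * real (Suc k)))"
    by (subst powr_half_sqrt[symmetric]) (simp_all add: powr_minus[symmetric])
  ultimately show ?thesis by simp
qed

lemma hermite_fun_eq: "hermite_fun k t = hermite_norm k * (poly (herm_poly k) t * exp (- (1/2 * t\<^sup>2)))"
  by (simp add: hermite_fun_def hermite_norm_def Hermite_poly_eq)

text \<open>The derivative is computed twice, once with the creation operator \<open>t -
  d/dt\<close> and once with the annihilation operator \<open>t + d/dt\<close>. The average of the
  two formulas contains no factor \<open>t\<close>, which is the form needed to stay within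
  products of Hermite functions.\<close>
lemma hermite_fun_deriv_raise:
  "(hermite_fun k has_real_derivative
     t * hermite_fun k t - sqrt (2 * real (Suc k)) * hermite_fun (Suc k) t) (at t)"
proof -
  have "sqrt (2 * real (Suc k)) * hermite_fun (Suc k) t =
      hermite_norm k * (poly (herm_poly (Suc k)) t * exp (- (1/2 * t\<^sup>2)))"
    by (simp only: hermite_fun_eq hermite_norm_Suc[of k] mult.assoc)
  then have "t * hermite_fun k t - sqrt (2 * real (Suc k)) * hermite_fun (Suc k) t =
     hermite_norm k * (poly (pderiv (herm_poly k) - smult (2 * (1/2)) ([:0, 1:] * herm_poly k)) t * exp (- (1/2 * t\<^sup>2)))"
    by (simp add: hermite_fun_eq algebra_simps)
  then show ?thesis
    using DERIV_cmult[OF has_real_derivative_poly_gauss[of "herm_poly k" "1/2" t], of "hermite_norm k"]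
    by (simp add: hermite_fun_eq[abs_def])
qed

lemma hermite_fun_deriv_lower:
  "(hermite_fun (Suc k) has_real_derivative
     sqrt (2 * real (Suc k)) * hermite_fun k t - t * hermite_fun (Suc k) t) (at t)"
proof -
  have "sqrt (2 * real (Suc k)) * hermite_fun k t =
      hermite_norm (Suc k) * (poly (pderiv (herm_poly (Suc k))) t * exp (- (1/2 * t\<^sup>2)))"
    by (simp add: hermite_fun_eq hermite_norm_Suc[of k] pderiv_herm_Suc del: herm_poly.simps of_nat_Suc)
  then have "sqrt (2 * real (Suc k)) * hermite_fun k t - t * hermite_fun (Suc k) t =
     hermite_norm (Suc k) * (poly (pderiv (herm_poly (Suc k)) - smult (2 * (1/2)) ([:0, 1:] * herm_poly (Suc k))) t
       * exp (- (1/2 * t\<^sup>2)))"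
    by (simp add: hermite_fun_eq algebra_simps del: herm_poly.simps)
  then show ?thesis
    using DERIV_cmult[OF has_real_derivative_poly_gauss[of "herm_poly (Suc k)" "1/2" t], of "hermite_norm (Suc k)"]
    by (simp add: hermite_fun_eq[abs_def] del: herm_poly.simps)
qed

text \<open>With integer indices the formulas below hold without a case distinction at
  \<open>0\<close>: the coefficient \<open>sqrt (k + 1)\<close> vanishes at \<open>k = -1\<close>,
  where it would multiply \<open>h\<^sub>0\<close>.\<close>
definition hermite_ext :: "int \<Rightarrow> real \<Rightarrow> real" where
  "hermite_ext k t = (if k < 0 then 0 else hermite_fun (nat k) t)"

lemma hermite_ext_deriv_raise:
  "(hermite_ext k has_real_derivative
     t * hermite_ext k t - sqrt (2 * real_of_int (k + 1)) * hermite_ext (k + 1) t) (at t)"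
proof (cases "k < 0")
  case True
  then have "hermite_ext k = (\<lambda>_. 0)" by (auto simp: hermite_ext_def)
  moreover have "sqrt (2 * real_of_int (k + 1)) * hermite_ext (k + 1) t = 0"
    using True by (cases "k + 1 = 0") (auto simp: hermite_ext_def)
  ultimately show ?thesis by (simp only: mult_zero_right diff_self DERIV_const)
next
  case False
  then have "hermite_ext k = hermite_fun (nat k)" "hermite_ext (k + 1) = hermite_fun (Suc (nat k))"
    "real_of_int (k + 1) = real (Suc (nat k))"
    by (auto simp: hermite_ext_def nat_add_distrib)
  then show ?thesis by (simp only: hermite_fun_deriv_raise)
qed

lemma hermite_ext_deriv_lower:
  "(hermite_ext k has_real_derivative
     sqrt (2 * real_of_int k) * hermite_ext (k - 1) t - t * hermite_ext k t) (at t)"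
proof (cases "k \<le> 0")
  case True
  show ?thesis
  proof (cases "k = 0")
    case True
    then have "hermite_ext k = hermite_fun 0"
      "t * hermite_fun 0 t - sqrt (2 * real (Suc 0)) * hermite_fun (Suc 0) t = - t * hermite_ext k t"
      by (auto simp: hermite_ext_def fun_eq_iff hermite_fun_eq hermite_norm_Suc[of 0])
    moreover have "sqrt (2 * real_of_int k) * hermite_ext (k - 1) t - t * hermite_ext k t = - t * hermite_ext k t"
      using True by simp
    ultimately show ?thesis using hermite_fun_deriv_raise[of 0 t] by (simp only:)
  next
    case False
    with True have "hermite_ext k = (\<lambda>_. 0)" "k - 1 < 0" by (auto simp: hermite_ext_def)
    then show ?thesis by (auto simp: hermite_ext_def)
  qed
next
  case False
  define m where "m = nat (k - 1)"
  have "hermite_ext k = hermite_fun (Suc m)" "hermite_ext (k - 1) = hermite_fun m"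
    "real_of_int k = real (Suc m)"
    using False by (auto simp: hermite_ext_def m_def nat_diff_distrib Suc_nat_eq_nat_zadd1)
  then show ?thesis by (simp only: hermite_fun_deriv_lower)
qed

definition hermite_deriv :: "int \<Rightarrow> real \<Rightarrow> real" where
  "hermite_deriv k t = sqrt (real_of_int k / 2) * hermite_ext (k - 1) t
     - sqrt (real_of_int (k + 1) / 2) * hermite_ext (k + 1) t"

lemma sqrt_double: "sqrt (2 * x) = 2 * sqrt (x / 2)"
proof -
  have "sqrt (2 * x) = sqrt (2\<^sup>2 * (x / 2))" by simp
  then show ?thesis by (simp only: real_sqrt_mult) simp
qed

lemma hermite_ext_deriv: "(hermite_ext k has_real_derivative hermite_deriv k t) (at t)"
proof -
  have "2 * hermite_deriv k t =
      (t * hermite_ext k t - sqrt (2 * real_of_int (k + 1)) * hermite_ext (k + 1) t)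
      + (sqrt (2 * real_of_int k) * hermite_ext (k - 1) t - t * hermite_ext k t)"
    unfolding sqrt_double hermite_deriv_def by (simp add: algebra_simps)
  moreover have "t * hermite_ext k t - sqrt (2 * real_of_int (k + 1)) * hermite_ext (k + 1) t =
      sqrt (2 * real_of_int k) * hermite_ext (k - 1) t - t * hermite_ext k t"
    by (rule DERIV_unique[OF hermite_ext_deriv_raise hermite_ext_deriv_lower])
  ultimately have "hermite_deriv k t =
      t * hermite_ext k t - sqrt (2 * real_of_int (k + 1)) * hermite_ext (k + 1) t" by simp
  then show ?thesis using hermite_ext_deriv_raise by (simp only:)
qed

text \<open>Hermite's equation comes from composing the two operators: the derivative is written
  with the raised index and the raised function is then differentiated with the lowering
  formula.\<close>
lemma hermite_deriv_deriv:
  "(hermite_deriv k has_real_derivative (t\<^sup>2 - 2 * real_of_int k - 1) * hermite_ext k t) (at t)"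
proof (cases "k < 0")
  case True
  then have "hermite_deriv k = (\<lambda>_. 0)" "k + 1 = 0 \<or> k + 1 < 0"
    by (auto simp: hermite_ext_def hermite_deriv_def[abs_def])
  with True show ?thesis by (auto simp: hermite_ext_def)
next
  case False
  have eq: "hermite_deriv k =
      (\<lambda>s. s * hermite_ext k s - sqrt (2 * real_of_int (k + 1)) * hermite_ext (k + 1) s)"
    using DERIV_unique[OF hermite_ext_deriv hermite_ext_deriv_raise] by blast
  have "((\<lambda>s. s * hermite_ext k s - sqrt (2 * real_of_int (k + 1)) * hermite_ext (k + 1) s) has_real_derivative
      (1 * hermite_ext k t + hermite_deriv k t * t)
      - sqrt (2 * real_of_int (k + 1))
        * (sqrt (2 * real_of_int (k + 1)) * hermite_ext k t - t * hermite_ext (k + 1) t)) (at t)"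
    using hermite_ext_deriv_lower[of "k + 1" t]
    by (intro DERIV_diff DERIV_mult DERIV_cmult DERIV_ident hermite_ext_deriv) simp
  moreover define r where "r = sqrt (2 * real_of_int (k + 1))"
  moreover have "r * r = 2 * real_of_int (k + 1)" using False by (simp add: r_def)
  then have "r * (r * hermite_ext k t) = 2 * real_of_int (k + 1) * hermite_ext k t"
    by (simp flip: mult.assoc)
  ultimately show ?thesis
    unfolding eq by (simp add: algebra_simps power2_eq_square)
qed

definition wronskian :: "int \<Rightarrow> int \<Rightarrow> real \<Rightarrow> real" where
  "wronskian m n t = hermite_deriv m t * hermite_ext n t - hermite_ext m t * hermite_deriv n t"

text \<open>The terms \<open>(t\<^sup>2 - 1) h\<^sub>m h\<^sub>n\<close> of the two instances of
  Hermite's equation cancel, which leaves the difference of the eigenvalues.\<close>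
lemma wronskian_deriv:
  "(wronskian m n has_real_derivative
     2 * real_of_int (n - m) * (hermite_ext m t * hermite_ext n t)) (at t)"
  unfolding wronskian_def[abs_def]
  by (rule derivative_eq_intros hermite_deriv_deriv hermite_ext_deriv refl)+ (simp add: algebra_simps)

section \<open>Weighted walks\<close>

text \<open>The sum, over all walks with \<open>N\<close> moves from \<open>0\<close> to
  \<open>y\<close>, of the product of the weights \<open>w x d\<close> of the moves
  \<open>d\<close> made at the points \<open>x\<close>.\<close>
primrec walk_coeff :: "('v \<Rightarrow> 'v \<Rightarrow> real) \<Rightarrow> 'v set \<Rightarrow> nat \<Rightarrow> 'v::ab_group_add \<Rightarrow> real" where
  "walk_coeff w D 0 y = (if y = 0 then 1 else 0)"
| "walk_coeff w D (Suc N) y = (\<Sum>d\<in>D. w (y - d) d * walk_coeff w D N (y - d))"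

definition walk_supp :: "('v \<Rightarrow> 'v \<Rightarrow> real) \<Rightarrow> 'v set \<Rightarrow> nat \<Rightarrow> 'v::ab_group_add set" where
  "walk_supp w D N = {y. walk_coeff w D N y \<noteq> 0}"

lemma walk_supp_0: "walk_supp w D 0 = {0}"
  by (auto simp: walk_supp_def)

lemma walk_supp_Suc: "walk_supp w D (Suc N) \<subseteq> (\<lambda>(x, d). x + d) ` (walk_supp w D N \<times> D)"
proof
  fix y assume "y \<in> walk_supp w D (Suc N)"
  then have "(\<Sum>d\<in>D. w (y - d) d * walk_coeff w D N (y - d)) \<noteq> 0" by (simp add: walk_supp_def)
  then obtain d where "d \<in> D" "w (y - d) d * walk_coeff w D N (y - d) \<noteq> 0"
    by (rule sum.not_neutral_contains_not_neutral)
  then show "y \<in> (\<lambda>(x, d). x + d) ` (walk_supp w D N \<times> D)"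
    by (intro image_eqI[of _ _ "(y - d, d)"]) (auto simp: walk_supp_def)
qed

lemma finite_walk_supp: "finite D \<Longrightarrow> finite (walk_supp w D N)"
proof (induction N)
  case (Suc N)
  then show ?case by (intro finite_subset[OF walk_supp_Suc]) auto
qed (simp add: walk_supp_0)

lemma card_walk_supp:
  assumes "finite D"
  shows "card (walk_supp w D N) \<le> card D ^ N"
proof (induction N)
  case (Suc N)
  have fin: "finite (walk_supp w D N \<times> D)" using assms finite_walk_supp by blast
  have "card (walk_supp w D (Suc N)) \<le> card ((\<lambda>(x, d). x + d) ` (walk_supp w D N \<times> D))"
    using fin by (intro card_mono walk_supp_Suc) auto
  also have "\<dots> \<le> card (walk_supp w D N \<times> D)" by (rule card_image_le[OF fin])
  also have "\<dots> \<le> card D ^ N * card D" using Suc.IH by (simp add: card_cartesian_product)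
  finally show ?case by (simp add: mult.commute)
qed (simp add: walk_supp_0)

lemma walk_coeff_bound:
  assumes "finite D" and "K \<ge> 0"
    and "\<And>M x d. M < N \<Longrightarrow> x \<in> walk_supp w D M \<Longrightarrow> d \<in> D \<Longrightarrow> \<bar>w x d\<bar> \<le> K"
  shows "\<bar>walk_coeff w D N y\<bar> \<le> (real (card D) * K) ^ N"
  using assms(3)
proof (induction N arbitrary: y)
  case (Suc N)
  have "\<bar>w (y - d) d * walk_coeff w D N (y - d)\<bar> \<le> K * (real (card D) * K) ^ N" if "d \<in> D" for d
  proof (cases "walk_coeff w D N (y - d) = 0")
    case True
    then show ?thesis using \<open>K \<ge> 0\<close> by simp
  next
    case False
    then have "\<bar>w (y - d) d\<bar> \<le> K" using that by (intro Suc.prems[of N]) (auto simp: walk_supp_def)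
    moreover have "\<bar>walk_coeff w D N (y - d)\<bar> \<le> (real (card D) * K) ^ N"
      by (intro Suc.IH Suc.prems) auto
    ultimately show ?thesis unfolding abs_mult using \<open>K \<ge> 0\<close> by (intro mult_mono) auto
  qed
  then have "(\<Sum>d\<in>D. \<bar>w (y - d) d * walk_coeff w D N (y - d)\<bar>) \<le> (\<Sum>d\<in>D. K * (real (card D) * K) ^ N)"
    by (rule sum_mono)
  then show ?case by (simp add: order_trans[OF sum_abs] mult.assoc)
qed simp

text \<open>If multiplication by \<open>s\<close> spreads each value \<open>T x\<close> over the
  neighbours of \<open>x\<close> according to the weights, then its \<open>N\<close>-th power
  spreads \<open>T 0\<close> over the end points of the walks of length \<open>N\<close>. The
  relation is only required at points that a walk of length less than \<open>N\<close> can reach: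
  further away, the derivatives that enter \<open>T\<close> may not exist.\<close>
lemma walk_coeff_sum:
  fixes T :: "'v::ab_group_add \<Rightarrow> 'b::real_algebra_1"
  assumes "finite D"
    and step: "\<And>M x. M < N \<Longrightarrow> x \<in> walk_supp w D M \<Longrightarrow>
                 s * T x = (\<Sum>d\<in>D. of_real (w x d) * T (x + d))"
  shows "s ^ N * T 0 = (\<Sum>y\<in>walk_supp w D N. of_real (walk_coeff w D N y) * T y)"
  using step
proof (induction N)
  case (Suc N)
  let ?A = "walk_supp w D N" and ?c = "walk_coeff w D N"
  let ?B = "(\<lambda>(x, d). x + d) ` (?A \<times> D)"
  have finA: "finite ?A" and finB: "finite ?B" using assms(1) finite_walk_supp by blast+
  have shift: "(\<Sum>y\<in>?B. of_real (w (y - d) d * ?c (y - d)) * T y) =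
      (\<Sum>x\<in>?A. of_real (?c x) * (of_real (w x d) * T (x + d)))" if "d \<in> D" for d
  proof -
    have "(\<Sum>y\<in>?B. of_real (w (y - d) d * ?c (y - d)) * T y) =
        (\<Sum>y\<in>(\<lambda>x. x + d) ` ?A. of_real (w (y - d) d * ?c (y - d)) * T y)"
    proof (rule sum.mono_neutral_right[OF finB])
      show "(\<lambda>x. x + d) ` ?A \<subseteq> ?B" using that by auto
      have "?c (y - d) = 0" if "y \<notin> (\<lambda>x. x + d) ` ?A" for y
      proof (rule ccontr)
        assume "?c (y - d) \<noteq> 0"
        then have "y - d \<in> ?A" by (simp add: walk_supp_def)
        then have "(y - d) + d \<in> (\<lambda>x. x + d) ` ?A" by (rule imageI)
        with that show False by simp
      qed
      then show "\<forall>y\<in>?B - (\<lambda>x. x + d) ` ?A. of_real (w (y - d) d * ?c (y - d)) * T y = 0"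
        by auto
    qed
    also have "\<dots> = (\<Sum>x\<in>?A. of_real (w x d * ?c x) * T (x + d))"
      by (subst sum.reindex) (auto simp: inj_on_def)
    also have "\<dots> = (\<Sum>x\<in>?A. of_real (?c x) * (of_real (w x d) * T (x + d)))"
      by (intro sum.cong refl) (simp only: of_real_mult[symmetric] mult.assoc[symmetric] mult.commute[of "w _ d"])
    finally show ?thesis .
  qed
  have "(\<Sum>y\<in>walk_supp w D (Suc N). of_real (walk_coeff w D (Suc N) y) * T y) =
      (\<Sum>y\<in>?B. of_real (walk_coeff w D (Suc N) y) * T y)"
    using walk_supp_Suc[of w D N] finB
    by (intro sum.mono_neutral_left finB) (auto simp: walk_supp_def simp del: walk_coeff.simps)
  also have "\<dots> = (\<Sum>d\<in>D. \<Sum>y\<in>?B. of_real (w (y - d) d * ?c (y - d)) * T y)"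
    by (subst sum.swap) (simp only: walk_coeff.simps of_real_sum sum_distrib_right)
  also have "\<dots> = (\<Sum>d\<in>D. \<Sum>x\<in>?A. of_real (?c x) * (of_real (w x d) * T (x + d)))"
    by (intro sum.cong refl shift)
  also have "\<dots> = (\<Sum>x\<in>?A. of_real (?c x) * (s * T x))"
    by (subst sum.swap) (simp add: Suc.prems[of N] sum_distrib_left cong: sum.cong)
  also have "\<dots> = s * (\<Sum>x\<in>?A. of_real (?c x) * T x)"
    unfolding sum_distrib_left by (intro sum.cong refl) (simp add: of_real_def)
  also have "\<dots> = s * (s ^ N * T 0)"
    by (subst Suc.IH[OF Suc.prems]) auto
  finally show ?case by (simp add: mult.assoc)
qed (simp add: walk_supp_0)

section \<open>The walk of the Hermite indices\<close>

text \<open>The point \<open>(\<alpha>, \<beta>, l)\<close> stands for the integral of the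
  \<open>l\<close>-th derivative against the Hermite functions with indices shifted by
  \<open>\<alpha>\<close> and \<open>\<beta>\<close>. The component \<open>l\<close> is an integer
  so that the points form a group.\<close>
definition moves :: "(int \<times> int \<times> int) set" where
  "moves = {(0, 0, 0), (-1, 0, 1), (1, 0, 1), (0, -1, 1), (0, 1, 1)}"

text \<open>The four moves that raise \<open>l\<close> carry the coefficients of the Wronskian of
  \<open>h\<^bsub>a + \<alpha>\<^esub>\<close> and \<open>h\<^bsub>b + \<beta>\<^esub>\<close>.
  Staying in place carries the difference between the factor \<open>2 (a - b)\<close> and the
  factor \<open>2 ((a + \<alpha>) - (b + \<beta>))\<close> that the Wronskian absorbs.\<close>
fun move_weight :: "nat \<Rightarrow> nat \<Rightarrow> int \<times> int \<times> int \<Rightarrow> int \<times> int \<times> int \<Rightarrow> real" where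
  "move_weight a b (\<alpha>, \<beta>, l) d =
     (if d = (-1, 0, 1) then sqrt (real_of_int (int a + \<alpha>) / 2)
      else if d = (1, 0, 1) then - sqrt (real_of_int (int a + \<alpha> + 1) / 2)
      else if d = (0, -1, 1) then - sqrt (real_of_int (int b + \<beta>) / 2)
      else if d = (0, 1, 1) then sqrt (real_of_int (int b + \<beta> + 1) / 2)
      else 2 * real_of_int (\<beta> - \<alpha>))"

definition hermite_coeff :: "nat \<Rightarrow> nat \<Rightarrow> nat \<Rightarrow> int \<times> int \<times> int \<Rightarrow> real" where
  "hermite_coeff N a b = walk_coeff (move_weight a b) moves N"

lemma finite_moves: "finite moves" and card_moves: "card moves = 5"
  by (simp_all add: moves_def)

text \<open>A move changes \<open>\<alpha>\<close> or \<open>\<beta>\<close> by one only when it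
  also raises \<open>l\<close> by one.\<close>
lemma hermite_supp_cone:
  "(\<alpha>, \<beta>, l) \<in> walk_supp (move_weight a b) moves N \<Longrightarrow> \<bar>\<alpha>\<bar> + \<bar>\<beta>\<bar> \<le> l \<and> l \<le> int N"
proof (induction N arbitrary: \<alpha> \<beta> l)
  case 0
  then show ?case by (simp add: walk_supp_0 zero_prod_def)
next
  case (Suc N)
  then obtain x d where x: "x \<in> walk_supp (move_weight a b) moves N" and d: "d \<in> moves"
    and eq: "(\<alpha>, \<beta>, l) = x + d"
    using subsetD[OF walk_supp_Suc Suc.prems] by (elim imageE SigmaE) simp
  obtain \<alpha>' \<beta>' l' where "x = (\<alpha>', \<beta>', l')" by (cases x)
  with x Suc.IH have "\<bar>\<alpha>'\<bar> + \<bar>\<beta>'\<bar> \<le> l' \<and> l' \<le> int N" by blast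
  with d eq \<open>x = _\<close> show ?case by (auto simp: moves_def)
qed

text \<open>The only walk that ends with \<open>l = 0\<close> never leaves the origin, where
  staying in place has weight \<open>0\<close>.\<close>
lemma hermite_supp_pos:
  assumes "(\<alpha>, \<beta>, l) \<in> walk_supp (move_weight a b) moves N" "N \<ge> 1"
  shows "1 \<le> l"
proof (rule ccontr)
  assume "\<not> 1 \<le> l"
  with hermite_supp_cone[OF assms(1)] have z: "(\<alpha>, \<beta>, l) = 0" by (auto simp: zero_prod_def)
  obtain M where N: "N = Suc M" using assms(2) by (cases N) auto
  have "move_weight a b (- d) d * walk_coeff (move_weight a b) moves M (- d) = 0" if d: "d \<in> moves" for d
  proof (cases "d = 0")
    case True
    then show ?thesis by (simp add: zero_prod_def)
  next
    case False
    with d have "- d \<notin> walk_supp (move_weight a b) moves M"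
      using hermite_supp_cone[of "fst (- d)" "fst (snd (- d))" "snd (snd (- d))" a b M]
      by (auto simp: moves_def zero_prod_def)
    then show ?thesis by (simp add: walk_supp_def)
  qed
  then have "walk_coeff (move_weight a b) moves N 0 = 0"
    unfolding N by (simp add: sum.neutral)
  with assms(1) z show False by (simp add: walk_supp_def)
qed

lemma abs_move_weight_le:
  assumes "\<bar>\<alpha>\<bar> + \<bar>\<beta>\<bar> \<le> int N"
  shows "\<bar>move_weight a b (\<alpha>, \<beta>, l) d\<bar> \<le> 2 * real (Suc N) * sqrt (bracket (real (max a b)))"
proof -
  define R where "R = bracket (real (max a b))"
  have R: "R = 1 + real (max a b)" "R \<ge> 1" by (auto simp: R_def bracket_def)
  \<comment> \<open>The radicand \<open>k / 2\<close> is negative if the shifted index is; \<open>sqrt\<close> is odd.\<close>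
  have rt: "\<bar>sqrt (real_of_int k / 2)\<bar> \<le> 2 * real (Suc N) * sqrt R"
    if "\<bar>k\<bar> \<le> int (max a b) + int N + 1" for k
  proof -
    have "\<bar>real_of_int k\<bar> / 2 \<le> real (Suc N) * R"
    proof -
      have "\<bar>real_of_int k\<bar> \<le> real (max a b) + real N + 1" using that by linarith
      also have "\<dots> \<le> real (Suc N) * R" unfolding R(1) by (simp add: algebra_simps)
      finally show ?thesis by simp
    qed
    also have "\<dots> \<le> (real (Suc N))\<^sup>2 * R"
      using R by (intro mult_right_mono) (auto simp: power2_eq_square)
    finally have "sqrt (\<bar>real_of_int k\<bar> / 2) \<le> real (Suc N) * sqrt R"
      by (metis real_sqrt_le_iff real_sqrt_mult real_sqrt_abs abs_of_nat)
    moreover have "\<bar>sqrt (real_of_int k / 2)\<bar> = sqrt (\<bar>real_of_int k\<bar> / 2)"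
      using real_sqrt_minus[of "real_of_int k / 2"] by (cases "k \<ge> 0") auto
    moreover have "0 \<le> real (Suc N) * sqrt R" using R by simp
    ultimately show ?thesis by linarith
  qed
  have "\<bar>\<beta> - \<alpha>\<bar> \<le> int N" using assms by linarith
  then have "real_of_int \<bar>\<beta> - \<alpha>\<bar> \<le> real_of_int (int N)" by (simp only: of_int_le_iff)
  then have "2 * \<bar>real_of_int (\<beta> - \<alpha>)\<bar> \<le> 2 * real (Suc N) * 1" by simp
  also have "\<dots> \<le> 2 * real (Suc N) * sqrt R" using R by (intro mult_left_mono) auto
  finally have st: "\<bar>2 * real_of_int (\<beta> - \<alpha>)\<bar> \<le> 2 * real (Suc N) * sqrt R"
    by (simp only: abs_mult abs_numeral)
  have "int a \<le> int (max a b)" "int b \<le> int (max a b)" by auto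
  then have "\<bar>int a + \<alpha>\<bar> \<le> int (max a b) + int N + 1" "\<bar>int a + \<alpha> + 1\<bar> \<le> int (max a b) + int N + 1"
    "\<bar>int b + \<beta>\<bar> \<le> int (max a b) + int N + 1" "\<bar>int b + \<beta> + 1\<bar> \<le> int (max a b) + int N + 1"
    using assms by linarith+
  from this[THEN rt] st show ?thesis unfolding R_def[symmetric] by simp
qed

text \<open>Each of the \<open>N\<close> moves contributes the bound for a single weight, times
  \<open>5\<close> for the choice of the move.\<close>
lemma abs_hermite_coeff_le:
  "\<bar>hermite_coeff N a b y\<bar> \<le> (10 * real (Suc N)) ^ N * bracket (real (max a b)) powr (real N / 2)"
proof -
  let ?R = "bracket (real (max a b))"
  have R: "?R > 0" by (simp add: bracket_def add_pos_nonneg)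
  have "\<bar>hermite_coeff N a b y\<bar> \<le> (real (card moves) * (2 * real (Suc N) * sqrt ?R)) ^ N"
    unfolding hermite_coeff_def
  proof (rule walk_coeff_bound[OF finite_moves])
    fix M x d assume "M < N" "x \<in> walk_supp (move_weight a b) moves M" "d \<in> moves"
    then show "\<bar>move_weight a b x d\<bar> \<le> 2 * real (Suc N) * sqrt ?R"
      using hermite_supp_cone[of "fst x" "fst (snd x)" "snd (snd x)" a b M]
        abs_move_weight_le[of "fst x" "fst (snd x)" N a b "snd (snd x)" d] by simp
  qed (use R in auto)
  also have "\<dots> = (10 * real (Suc N)) ^ N * sqrt ?R ^ N"
    unfolding power_mult_distrib[symmetric] by (simp only: card_moves) (simp add: algebra_simps)
  also have "sqrt ?R ^ N = ?R powr (real N / 2)"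
    using R by (simp add: powr_half_sqrt[symmetric] powr_power)
  finally show ?thesis .
qed

section \<open>Directional derivatives with vanishing integral\<close>

lemma Basis_vec_real: "(Basis :: (real ^ 'n) set) = range (\<lambda>j. axis j 1)"
  by (auto simp: Basis_vec_def)

lemma measurable_vec_component [measurable]: "(\<lambda>x :: real ^ 'n. x $ j) \<in> borel_measurable borel"
  by (intro borel_measurable_continuous_onI continuous_intros)

lemma nn_integral_vec_prod:
  fixes k :: "'n::finite \<Rightarrow> real \<Rightarrow> ennreal"
  assumes k: "\<And>j. k j \<in> borel_measurable borel"
  shows "(\<integral>\<^sup>+x. (\<Prod>j\<in>UNIV. k j ((x :: real ^ 'n) $ j)) \<partial>lborel) = (\<Prod>j\<in>UNIV. \<integral>\<^sup>+t. k j t \<partial>lborel)"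
proof -
  define e where "e = (\<lambda>j :: 'n. axis j (1::real))"
  have inj: "inj e" by (auto simp: inj_def e_def axis_eq_axis)
  have reindex: "(\<Prod>b\<in>Basis. g b) = (\<Prod>j\<in>UNIV. g (e j))" for g :: "real ^ 'n \<Rightarrow> ennreal"
    using prod.reindex[OF inj, of g] by (simp add: Basis_vec_real e_def)
  have "(\<integral>\<^sup>+x. (\<Prod>b\<in>Basis. k (inv e b) ((x :: real ^ 'n) \<bullet> b)) \<partial>lborel) =
      (\<Prod>b\<in>(Basis :: (real ^ 'n) set). \<integral>\<^sup>+t. k (inv e b) t \<partial>lborel)"
    by (rule nn_integral_lborel_prod) (auto simp: k)
  then show ?thesis
    unfolding reindex inv_f_f[OF inj] by (simp add: e_def inner_axis)
qed

lemma has_bochner_integral_vec_prod: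
  fixes k :: "'n::finite \<Rightarrow> real \<Rightarrow> real"
  assumes int: "\<And>j. integrable lborel (k j)" and nn: "\<And>j t. 0 \<le> k j t"
  shows "has_bochner_integral lborel (\<lambda>x :: real ^ 'n. \<Prod>j\<in>UNIV. k j (x $ j))
           (\<Prod>j\<in>UNIV. integral\<^sup>L lborel (k j))"
proof (rule has_bochner_integral_nn_integral)
  have [measurable]: "k j \<in> borel_measurable borel" for j
    using borel_measurable_integrable[OF int[of j]] by simp
  show "(\<lambda>x :: real ^ 'n. \<Prod>j\<in>UNIV. k j (x $ j)) \<in> borel_measurable lborel" by measurable
  show "0 \<le> (\<Prod>j\<in>UNIV. integral\<^sup>L lborel (k j))" by (intro prod_nonneg) (simp add: nn)
  have "(\<integral>\<^sup>+x. ennreal (\<Prod>j\<in>UNIV. k j ((x :: real ^ 'n) $ j)) \<partial>lborel) =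
      (\<integral>\<^sup>+x. (\<Prod>j\<in>UNIV. ennreal (k j ((x :: real ^ 'n) $ j))) \<partial>lborel)"
    by (simp add: prod_ennreal nn)
  also have "\<dots> = (\<Prod>j\<in>UNIV. \<integral>\<^sup>+t. ennreal (k j t) \<partial>lborel)"
    by (rule nn_integral_vec_prod) measurable
  also have "\<dots> = ennreal (\<Prod>j\<in>UNIV. integral\<^sup>L lborel (k j))"
    by (simp add: nn_integral_eq_integral int nn prod_ennreal)
  finally show "(\<integral>\<^sup>+x. ennreal (\<Prod>j\<in>UNIV. k j ((x :: real ^ 'n) $ j)) \<partial>lborel) =
      ennreal (\<Prod>j\<in>UNIV. integral\<^sup>L lborel (k j))" .
qed (simp add: prod_nonneg nn)

text \<open>Replacing one factor of a product function by an indicator shows that a slab of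
  thickness \<open>d - c\<close> carries an integral proportional to \<open>d - c\<close>.\<close>
lemma has_bochner_integral_slab:
  fixes k :: "'n::finite \<Rightarrow> real \<Rightarrow> real"
  assumes int: "\<And>j. integrable lborel (k j)" and nn: "\<And>j t. 0 \<le> k j t" and "c \<le> d"
  shows "has_bochner_integral lborel
     (\<lambda>x :: real ^ 'n. indicator {c..d} (x $ i) * (\<Prod>j\<in>UNIV - {i}. k j (x $ j)))
     ((d - c) * (\<Prod>j\<in>UNIV - {i}. integral\<^sup>L lborel (k j)))"
proof -
  let ?k = "\<lambda>j. if j = i then indicator {c..d} else k j"
  have split: "(\<Prod>j\<in>UNIV. h j) = h i * (\<Prod>j\<in>UNIV - {i}. h j)" for h :: "'n \<Rightarrow> real"
    by (rule prod.remove) auto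
  have "has_bochner_integral lborel (\<lambda>x :: real ^ 'n. \<Prod>j\<in>UNIV. ?k j (x $ j))
      (\<Prod>j\<in>UNIV. integral\<^sup>L lborel (?k j))"
    by (rule has_bochner_integral_vec_prod) (use \<open>c \<le> d\<close> in \<open>auto simp: int nn intro!: integrable_real_indicator\<close>)
  then show ?thesis unfolding split using \<open>c \<le> d\<close> by simp
qed

lemma has_vector_derivative_along_line:
  fixes F :: "'a::real_normed_vector \<Rightarrow> 'b::real_normed_vector"
  assumes "\<And>x. ((\<lambda>t. F (x + t *\<^sub>R e)) has_vector_derivative D x) (at 0)"
  shows "((\<lambda>t. F (x + t *\<^sub>R e)) has_vector_derivative D (x + s *\<^sub>R e)) (at s)"
proof -
  have "((\<lambda>t. F ((x + s *\<^sub>R e) + t *\<^sub>R e)) \<circ> (\<lambda>t. t - s) has_vector_derivative 1 *\<^sub>R D (x + s *\<^sub>R e)) (at s)"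
    by (rule vector_diff_chain_at) (auto intro!: derivative_eq_intros assms)
  moreover have "(\<lambda>t. F ((x + s *\<^sub>R e) + t *\<^sub>R e)) \<circ> (\<lambda>t. t - s) = (\<lambda>t. F (x + t *\<^sub>R e))"
    by (simp add: fun_eq_iff algebra_simps)
  ultimately show ?thesis by simp
qed

text \<open>Translating a box in the direction \<open>i\<close> changes it only within two slabs
  of thickness \<open>s\<close> along its faces orthogonal to that direction. The bound is linear
  in \<open>s\<close>, so it passes to the derivative with respect to the translation.\<close>
lemma integral_translated_box_bound:
  fixes F :: "real ^ 'n \<Rightarrow> complex" and k :: "'n \<Rightarrow> real \<Rightarrow> real"
  assumes F: "continuous_on UNIV F"
    and k: "\<And>j. integrable lborel (k j)" "\<And>j t. 0 \<le> k j t"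
    and decay: "\<And>x. B \<le> \<bar>x $ i\<bar> \<Longrightarrow> norm (F x) \<le> \<epsilon> * (\<Prod>j\<in>UNIV - {i}. k j (x $ j))"
    and s: "0 < s" "a $ i + s \<le> - B" "B \<le> b $ i" and "0 \<le> \<epsilon>"
  shows "norm (integral (cbox a b) (\<lambda>x. F (x + s *\<^sub>R axis i 1)) - integral (cbox a b) F)
           \<le> 2 * s * \<epsilon> * (\<Prod>j\<in>UNIV - {i}. integral\<^sup>L lborel (k j))"
proof -
  define e :: "real ^ 'n" where "e = s *\<^sub>R axis i 1"
  define \<kappa> where "\<kappa> = (\<lambda>x :: real ^ 'n. \<Prod>j\<in>UNIV - {i}. k j (x $ j))"
  define K where "K = (\<Prod>j\<in>UNIV - {i}. integral\<^sup>L lborel (k j))"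
  define \<Phi> where "\<Phi> = (\<lambda>x :: real ^ 'n. \<epsilon> * (indicator {a $ i..a $ i + s} (x $ i) * \<kappa> x
      + indicator {b $ i..b $ i + s} (x $ i) * \<kappa> x))"
  have box: "integrable lborel (\<lambda>x. indicator (cbox a b) x *\<^sub>R g x)
      \<and> integral (cbox a b) g = (\<integral>x. indicator (cbox a b) x *\<^sub>R g x \<partial>lborel)"
    if "continuous_on UNIV g" for g :: "real ^ 'n \<Rightarrow> complex"
  proof -
    have int: "integrable lborel (\<lambda>x. indicator (cbox a b) x *\<^sub>R g x)"
      by (rule borel_integrable_compact) (auto intro: continuous_on_subset[OF that])
    then show ?thesis
      using set_borel_integral_eq_integral(2)[of "cbox a b" g]
      by (simp add: set_integrable_def set_lebesgue_integral_def)
  qed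
  have contFe: "continuous_on UNIV (\<lambda>x. F (x + e))"
    by (intro continuous_on_compose2[OF F] continuous_intros) auto
  have shift_meas: "(+) e \<in> measurable lborel lborel"
    by (simp add: borel_measurable_continuous_onI continuous_intros)
  define G where "G = (\<lambda>y. indicator (cbox a b) (y - e) *\<^sub>R F y)"
  have [measurable]: "F \<in> borel_measurable borel"
    by (rule borel_measurable_continuous_onI[OF F])
  have Gmeas: "G \<in> borel_measurable lborel"
    unfolding G_def by measurable
  have Gshift: "G (e + x) = indicator (cbox a b) x *\<^sub>R F (x + e)" for x
    by (simp add: G_def add.commute)
  have "integrable (distr lborel borel ((+) e)) G"
    using Gmeas box[OF contFe] by (subst integrable_distr_eq) (auto simp: Gshift)
  then have intG: "integrable lborel G" by (simp add: lborel_distr_plus)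
  have "integral\<^sup>L (distr lborel borel ((+) e)) G = (\<integral>x. G (e + x) \<partial>lborel)"
    using Gmeas by (intro integral_distr) auto
  then have Geq: "integral\<^sup>L lborel G = integral (cbox a b) (\<lambda>x. F (x + e))"
    using box[OF contFe] by (simp add: lborel_distr_plus Gshift)
  have \<Phi>: "has_bochner_integral lborel \<Phi> (\<epsilon> * ((a $ i + s - a $ i) * K + (b $ i + s - b $ i) * K))"
    unfolding \<Phi>_def \<kappa>_def K_def
    by (intro has_bochner_integral_mult_right has_bochner_integral_add has_bochner_integral_slab k)
       (use s in auto)
  have bound: "norm (G y - indicator (cbox a b) y *\<^sub>R F y) \<le> \<Phi> y" for y
  proof -
    have \<kappa>: "0 \<le> \<kappa> y" unfolding \<kappa>_def by (intro prod_nonneg) (simp add: k)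
    then have nn: "0 \<le> \<Phi> y" unfolding \<Phi>_def using \<open>0 \<le> \<epsilon>\<close> by simp
    show ?thesis
    proof (cases "y - e \<in> cbox a b \<longleftrightarrow> y \<in> cbox a b")
      case True
      then show ?thesis using nn by (auto simp: G_def indicator_def)
    next
      case False
      have ye: "(y - e) $ j = (if j = i then y $ i - s else y $ j)" for j
        by (simp add: e_def axis_def)
      have "(y - e \<in> cbox a b) \<longleftrightarrow> a $ i \<le> y $ i - s \<and> y $ i - s \<le> b $ i
          \<and> (\<forall>j. j \<noteq> i \<longrightarrow> a $ j \<le> y $ j \<and> y $ j \<le> b $ j)"
        unfolding mem_box_cart ye by auto
      moreover have "y \<in> cbox a b \<longleftrightarrow> a $ i \<le> y $ i \<and> y $ i \<le> b $ i
          \<and> (\<forall>j. j \<noteq> i \<longrightarrow> a $ j \<le> y $ j \<and> y $ j \<le> b $ j)"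
        unfolding mem_box_cart by auto
      ultimately have slab: "y $ i \<in> {a $ i..a $ i + s} \<or> y $ i \<in> {b $ i..b $ i + s}"
        using False \<open>0 < s\<close> unfolding atLeastAtMost_iff by argo
      then have "B \<le> \<bar>y $ i\<bar>" using s by auto
      then have "norm (F y) \<le> \<epsilon> * \<kappa> y" unfolding \<kappa>_def by (rule decay)
      also have "\<dots> \<le> \<epsilon> * (indicator {a $ i..a $ i + s} (y $ i) * \<kappa> y
          + indicator {b $ i..b $ i + s} (y $ i) * \<kappa> y)"
        using slab \<kappa> by (intro mult_left_mono \<open>0 \<le> \<epsilon>\<close>) (auto simp: indicator_def)
      finally have "norm (F y) \<le> \<Phi> y" by (simp add: \<Phi>_def)
      with False show ?thesis by (auto simp: G_def indicator_def)
    qed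
  qed
  have "integral (cbox a b) (\<lambda>x. F (x + e)) - integral (cbox a b) F =
      (\<integral>y. G y - indicator (cbox a b) y *\<^sub>R F y \<partial>lborel)"
    using box[OF F] intG Geq by simp
  also have "norm \<dots> \<le> (\<integral>y. \<Phi> y \<partial>lborel)"
    using bound \<Phi> intG box[OF F]
    by (intro order_trans[OF integral_norm_bound integral_mono])
       (auto simp: has_bochner_integral_iff simp del: scaleR_conv_of_real)
  also have "\<dots> = 2 * s * \<epsilon> * K"
    using \<Phi> by (simp add: has_bochner_integral_iff algebra_simps)
  finally show ?thesis by (simp add: e_def K_def)
qed

text \<open>The integral of \<open>D\<close> over a box is the derivative, at zero, of the
  integral of \<open>F\<close> over the translated box, which takes the place of an iterated
  integral and the fundamental theorem of calculus. By the previous lemma this derivative is small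
  for every box that contains a large ball. Only the size of \<open>F\<close> near two faces of
  the box enters, so the integral of \<open>D\<close> over the whole space may converge only
  conditionally.\<close>
lemma has_integral_partial_derivative_zero:
  fixes F D :: "real ^ 'n \<Rightarrow> complex" and k :: "'n \<Rightarrow> real \<Rightarrow> real"
  assumes F: "continuous_on UNIV F" and D: "continuous_on UNIV D"
    and deriv: "\<And>x. ((\<lambda>t. F (x + t *\<^sub>R axis i 1)) has_vector_derivative D x) (at 0)"
    and k: "\<And>j. integrable lborel (k j)" "\<And>j t. 0 \<le> k j t"
    and decay: "\<And>\<epsilon>. 0 < \<epsilon> \<Longrightarrow>
      \<exists>B. \<forall>x. B \<le> \<bar>x $ i\<bar> \<longrightarrow> norm (F x) \<le> \<epsilon> * (\<Prod>j\<in>UNIV - {i}. k j (x $ j))"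
  shows "(D has_integral 0) UNIV"
proof -
  define e :: "real ^ 'n" where "e = axis i 1"
  define K where "K = (\<Prod>j\<in>UNIV - {i}. integral\<^sup>L lborel (k j))"
  have "0 \<le> K" unfolding K_def by (intro prod_nonneg) (simp add: k)
  have "\<exists>B>0. \<forall>a b. ball 0 B \<subseteq> cbox a b \<longrightarrow> norm (integral (cbox a b) D) < \<delta>"
    if "0 < \<delta>" for \<delta>
  proof -
    \<comment> \<open>The two slabs then contribute at most \<open>\<delta> / 2\<close>, and the error of the difference quotient \<open>\<delta> / 4\<close>.\<close>
    define \<epsilon> where "\<epsilon> = \<delta> / (4 * (K + 1))"
    have "0 < \<epsilon>" using \<open>0 \<le> K\<close> \<open>0 < \<delta>\<close> by (simp add: \<epsilon>_def)
    then obtain B where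
      B: "\<And>x. B \<le> \<bar>x $ i\<bar> \<Longrightarrow> norm (F x) \<le> \<epsilon> * (\<Prod>j\<in>UNIV - {i}. k j (x $ j))"
      using decay by blast
    \<comment> \<open>The margin \<open>2\<close> keeps the faces beyond \<open>\<bar>B\<bar>\<close> for all translations \<open>s \<le> 1\<close>.\<close>
    have "norm (integral (cbox a b) D) < \<delta>" if ball: "ball 0 (\<bar>B\<bar> + 2) \<subseteq> cbox a b" for a b
    proof -
      have "(\<bar>B\<bar> + 1) *\<^sub>R e \<in> cbox a b" "(- (\<bar>B\<bar> + 1)) *\<^sub>R e \<in> cbox a b"
        by (intro subsetD[OF ball]; simp add: e_def)+
      then have ab: "a $ i \<le> - (\<bar>B\<bar> + 1)" "\<bar>B\<bar> + 1 \<le> b $ i"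
        unfolding mem_box_cart by (auto simp: e_def dest!: spec[of _ i])
      define J where "J = (\<lambda>s. integral (cbox a b) (\<lambda>x. F (x + s *\<^sub>R e)))"
      have "(J has_vector_derivative integral (cbox a b) (\<lambda>x. D (x + 0 *\<^sub>R e))) (at 0 within UNIV)"
        unfolding J_def
      proof (rule leibniz_rule_vector_derivative)
        fix s x
        show "((\<lambda>s. F (x + s *\<^sub>R e)) has_vector_derivative D (x + s *\<^sub>R e)) (at s within UNIV)"
          using has_vector_derivative_along_line[OF deriv] by (simp add: e_def)
        show "(\<lambda>x. F (x + s *\<^sub>R e)) integrable_on cbox a b"
          by (intro integrable_continuous continuous_on_compose2[OF F] continuous_intros) auto
      next
        show "continuous_on (UNIV \<times> cbox a b) (\<lambda>(s, x). D (x + s *\<^sub>R e))"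
          unfolding split_beta by (intro continuous_on_compose2[OF D] continuous_intros) auto
      qed auto
      then have "(J has_derivative (\<lambda>s. s *\<^sub>R integral (cbox a b) D)) (at 0)"
        by (simp add: has_vector_derivative_def)
      from this[unfolded has_derivative_at_alt, THEN conjunct2, THEN spec, of "\<delta> / 4"]
      have "\<exists>d>0. \<forall>s. norm (s - 0) < d \<longrightarrow>
          norm (J s - J 0 - (s - 0) *\<^sub>R integral (cbox a b) D) \<le> \<delta> / 4 * norm (s - 0)"
        using \<open>0 < \<delta>\<close> by simp
      then obtain d where "0 < d" and
        d: "\<And>s. \<bar>s\<bar> < d \<Longrightarrow> norm (J s - J 0 - s *\<^sub>R integral (cbox a b) D) \<le> \<delta> / 4 * \<bar>s\<bar>"
        by auto
      define s where "s = min 1 (d / 2)"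
      have s: "0 < s" "s \<le> 1" "s < d" using \<open>0 < d\<close> by (auto simp: s_def)
      have "norm (J s - J 0) \<le> 2 * s * \<epsilon> * K"
        unfolding J_def K_def e_def using s ab \<open>0 < \<epsilon>\<close>
          integral_translated_box_bound[OF F k, where B = "\<bar>B\<bar>" and i = i and \<epsilon> = \<epsilon> and s = s and a = a and b = b] B by auto
      moreover have "norm (s *\<^sub>R integral (cbox a b) D)
          \<le> norm (J s - J 0) + norm (J s - J 0 - s *\<^sub>R integral (cbox a b) D)"
        using norm_triangle_ineq4[of "J s - J 0" "J s - J 0 - s *\<^sub>R integral (cbox a b) D"] by simp
      ultimately have "s * norm (integral (cbox a b) D) \<le> s * (2 * \<epsilon> * K + \<delta> / 4)"
        using d[of s] s by (simp add: algebra_simps)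
      then have "norm (integral (cbox a b) D) \<le> 2 * \<epsilon> * K + \<delta> / 4" using s by simp
      also have "2 * \<epsilon> * K \<le> \<delta> / 2"
        using \<open>0 \<le> K\<close> \<open>0 < \<delta>\<close> by (simp add: \<epsilon>_def field_simps)
      finally show ?thesis using \<open>0 < \<delta>\<close> by simp
    qed
    then show ?thesis by (intro exI[of _ "\<bar>B\<bar> + 2"]) auto
  qed
  moreover have "D integrable_on cbox a b" for a b
    by (intro integrable_continuous continuous_on_subset[OF D]) auto
  ultimately show ?thesis by (subst has_integral_alt') simp
qed

section \<open>Polynomials times Gaussians\<close>

lemma herm_nonzero: "herm_poly k \<noteq> 0"
  using herm_bezout[of k] by auto

lemma integrable_poly_gauss: "integrable lborel (\<lambda>t. poly (p :: real poly) t * exp (- (1/2 * t\<^sup>2)))"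
proof -
  have "integrable lborel (\<lambda>t. \<Sum>k\<le>degree p. (coeff p k * sqrt (2 * pi)) * (std_normal_density t * t ^ k))"
    by (intro Bochner_Integration.integrable_sum integrable_mult_right integrable_std_normal_moment)
  moreover have "(\<Sum>k\<le>degree p. (coeff p k * sqrt (2 * pi)) * (std_normal_density t * t ^ k))
      = poly p t * exp (- (1/2 * t\<^sup>2))" for t
    unfolding poly_altdef sum_distrib_right
    by (intro sum.cong refl) (simp add: std_normal_density_def)
  ultimately show ?thesis by simp
qed

lemma poly_gauss_tendsto_0:
  "((\<lambda>t. poly p t * exp (- (1/2 * t\<^sup>2))) \<longlongrightarrow> (0::real)) at_infinity"
proof -
  define n where "n = Suc (degree p)"
  obtain M where M: "\<And>z. M \<le> norm z \<Longrightarrow> norm (\<Sum>k\<le>degree p. coeff p k * z ^ k) \<le> 1 * norm z ^ n"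
    using polyfun_extremal_lemma[of 1 "coeff p" "degree p"] unfolding n_def by auto
  have "norm (poly p t * exp (- (1/2 * t\<^sup>2))) \<le> norm t ^ n / exp (norm t)" if "max M 2 \<le> norm t" for t
  proof -
    have "2 * norm t \<le> norm t * norm t" using that by (intro mult_right_mono) auto
    then have "exp (- (1/2 * t\<^sup>2)) \<le> exp (- norm t)" by (simp add: power2_eq_square abs_mult_self_eq)
    moreover have "norm (poly p t) \<le> norm t ^ n" using M[of t] that by (simp add: poly_altdef)
    ultimately have "norm (poly p t) * exp (- (1/2 * t\<^sup>2)) \<le> norm t ^ n * exp (- norm t)"
      by (intro mult_mono) auto
    then show ?thesis by (simp only: real_norm_def abs_mult abs_exp_cancel exp_minus[of "\<bar>t\<bar>"] divide_inverse)
  qed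
  then have "\<forall>\<^sub>F t in at_infinity. norm (poly p t * exp (- (1/2 * t\<^sup>2))) \<le> norm t ^ n / exp (norm t)"
    unfolding eventually_at_infinity by blast
  moreover have "((\<lambda>t::real. norm t ^ n / exp (norm t)) \<longlongrightarrow> 0) at_infinity"
    by (rule filterlim_compose[OF tendsto_power_div_exp_0 filterlim_norm_at_top])
  ultimately show ?thesis by (rule Lim_null_comparison)
qed

lemma poly_bounded_below_at_infinity:
  fixes p :: "real poly"
  assumes "p \<noteq> 0"
  shows "\<exists>\<delta>>0. \<forall>\<^sub>F t in at_infinity. \<delta> \<le> \<bar>poly p t\<bar>"
proof (cases "degree p = 0")
  case True
  then obtain c where "p = [:c:]" by (rule degree_eq_zeroE)
  with assms show ?thesis by (intro exI[of _ "\<bar>c\<bar>"]) auto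
next
  case False
  with assms have "\<forall>\<^sub>F t in at_infinity. 1 \<le> norm (\<Sum>k\<le>degree p. coeff p k * t ^ k)"
    by (intro polyfun_extremal exI[of _ "degree p"]) auto
  then show ?thesis by (intro exI[of _ 1]) (simp add: poly_altdef)
qed

text \<open>Products of two Hermite functions have this form. The weight is the square of the
  Gaussian of a single Hermite function, so that half of it is left over after division by
  one.\<close>
definition gauss_poly :: "real poly \<Rightarrow> real \<Rightarrow> real" where
  "gauss_poly r t = poly r t * exp (- t\<^sup>2)"

text \<open>The action of differentiation on the polynomial factor.\<close>
definition gauss_deriv :: "real poly \<Rightarrow> real poly" where
  "gauss_deriv r = pderiv r - [:0, 2:] * r"

lemma gauss_poly_deriv: "(gauss_poly r has_real_derivative gauss_poly (gauss_deriv r) t) (at t)"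
  using has_real_derivative_poly_gauss[of r 1 t]
  by (simp add: gauss_poly_def[abs_def] gauss_deriv_def algebra_simps)

lemma gauss_poly_add: "gauss_poly (p + q) = (\<lambda>t. gauss_poly p t + gauss_poly q t)"
  by (simp add: gauss_poly_def fun_eq_iff algebra_simps)

lemma continuous_on_gauss_poly [continuous_intros]:
  "continuous_on S f \<Longrightarrow> continuous_on S (\<lambda>x. gauss_poly r (f x))"
  unfolding gauss_poly_def by (intro continuous_intros)

text \<open>Far from its zeros a Hermite polynomial is bounded below, so the remaining Gaussian
  dominates the quotient.\<close>
lemma gauss_poly_over_hermite_tendsto_0:
  "((\<lambda>t. gauss_poly r t / hermite_fun k t) \<longlongrightarrow> 0) at_infinity"
proof -
  obtain \<delta> where "0 < \<delta>" and \<delta>: "\<forall>\<^sub>F t in at_infinity. \<delta> \<le> \<bar>poly (herm_poly k) t\<bar>"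
    using poly_bounded_below_at_infinity[OF herm_nonzero] by blast
  have "\<forall>\<^sub>F t in at_infinity. norm (gauss_poly r t / hermite_fun k t)
      \<le> norm (poly r t * exp (- (1/2 * t\<^sup>2))) / (hermite_norm k * \<delta>)"
    using \<delta>
  proof eventually_elim
    case (elim t)
    have "exp (- t\<^sup>2) = exp (- (1/2 * t\<^sup>2)) * exp (- (1/2 * t\<^sup>2))"
      by (simp flip: exp_add)
    then have "norm (gauss_poly r t / hermite_fun k t) =
        norm (poly r t * exp (- (1/2 * t\<^sup>2))) / (hermite_norm k * \<bar>poly (herm_poly k) t\<bar>)"
      using hermite_norm_pos[of k] by (simp add: gauss_poly_def hermite_fun_eq abs_mult)
    also have "\<dots> \<le> norm (poly r t * exp (- (1/2 * t\<^sup>2))) / (hermite_norm k * \<delta>)"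
      using elim \<open>0 < \<delta>\<close> hermite_norm_pos[of k] by (intro divide_left_mono mult_left_mono mult_pos_pos) auto
    finally show ?case .
  qed
  moreover have "((\<lambda>t. norm (poly r t * exp (- (1/2 * t\<^sup>2))) / (hermite_norm k * \<delta>)) \<longlongrightarrow> 0) at_infinity"
    using tendsto_divide[OF tendsto_norm[OF poly_gauss_tendsto_0[of r]] tendsto_const] 
      \<open>0 < \<delta>\<close> hermite_norm_pos[of k] by fastforce
  ultimately show ?thesis by (rule Lim_null_comparison)
qed

lemma hermite_ext_mult_gauss_poly: "\<exists>r. \<forall>t. hermite_ext m t * hermite_ext n t = gauss_poly r t"
proof -
  have ext: "\<exists>p. \<forall>t. hermite_ext m t = poly p t * exp (- (1/2 * t\<^sup>2))" for m
    by (intro exI[of _ "if m < 0 then 0 else smult (hermite_norm (nat m)) (herm_poly (nat m))"])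
       (simp add: hermite_ext_def hermite_fun_eq)
  obtain p where "\<And>t. hermite_ext m t = poly p t * exp (- (1/2 * t\<^sup>2))" using ext by blast
  moreover obtain q where "\<And>t. hermite_ext n t = poly q t * exp (- (1/2 * t\<^sup>2))" using ext by blast
  moreover have "exp (- t\<^sup>2) = exp (- (1/2 * t\<^sup>2)) * exp (- (1/2 * t\<^sup>2))" for t :: real
    by (simp flip: exp_add)
  ultimately show ?thesis by (intro exI[of _ "p * q"]) (simp add: gauss_poly_def)
qed

section \<open>Separating one variable\<close>

lemma continuous_on_hermite_fun [continuous_intros]:
  "continuous_on S f \<Longrightarrow> continuous_on S (\<lambda>x. hermite_fun k (f x))"
  unfolding hermite_fun_eq by (intro continuous_intros)

text \<open>The part of \<open>hermite \<xi>\<close> that is constant in the direction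
  \<open>i\<close>.\<close>
definition hermite_cofactor :: "'n \<Rightarrow> nat ^ 'n \<Rightarrow> real ^ 'n \<Rightarrow> real" where
  "hermite_cofactor i \<xi> x = (\<Prod>j\<in>UNIV - {i}. hermite_fun (\<xi> $ j) (x $ j))"

lemma continuous_on_hermite_cofactor: "continuous_on S (hermite_cofactor i \<xi>)"
  unfolding hermite_cofactor_def[abs_def] by (intro continuous_intros)

lemma hermite_eq_cofactor: "hermite \<xi> x = hermite_fun (\<xi> $ i) (x $ i) * hermite_cofactor i \<xi> x"
  unfolding hermite_def hermite_cofactor_def by (rule prod.remove) auto

lemma hermite_int_shift:
  "hermite_int (shift \<xi> \<alpha> i) x = hermite_ext (int (\<xi> $ i) + \<alpha>) (x $ i) * hermite_cofactor i \<xi> x"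
proof (cases "int (\<xi> $ i) + \<alpha> < 0")
  case True
  then have "\<exists>j. shift \<xi> \<alpha> i $ j < 0" by (intro exI[of _ i]) (simp add: shift_def)
  with True show ?thesis by (simp add: hermite_int_def hermite_ext_def)
next
  case False
  then have "\<not> (\<exists>j. shift \<xi> \<alpha> i $ j < 0)" by (auto simp: shift_def axis_def not_less)
  then have "hermite_int (shift \<xi> \<alpha> i) x = hermite (\<chi> j. nat (shift \<xi> \<alpha> i $ j)) x"
    by (simp add: hermite_int_def)
  also have "\<dots> = hermite_ext (int (\<xi> $ i) + \<alpha>) (x $ i) * hermite_cofactor i \<xi> x"
    unfolding hermite_eq_cofactor[of _ _ i] hermite_cofactor_def using False
    by (auto simp: hermite_ext_def shift_def axis_def intro!: prod.cong)
  finally show ?thesis .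
qed

lemma hermite_cofactor_translate:
  "hermite_cofactor i \<xi> (x + t *\<^sub>R axis i 1) = hermite_cofactor i \<xi> x"
  unfolding hermite_cofactor_def by (intro prod.cong) (auto simp: axis_def)
section \<open>Convergence of the integrals and integration by parts\<close>

text \<open>The sequence \<open>f\<close> abstracts from the iterated derivatives
  \<open>\<partial>\<^sub>i\<^sup>l g(\<cdot>, \<xi>, \<eta>)\<close>. Their decay enters as
  boundedness of \<open>f l * h\<^sub>\<xi>\<close>; convergence then comes from the Gaussian
  factor of \<open>h\<^sub>\<eta>\<close>.\<close>
locale hermite_weighted_derivatives =
  fixes f :: "nat \<Rightarrow> real ^ 'n \<Rightarrow> complex" and N :: nat and i :: 'n and \<xi> \<eta> :: "nat ^ 'n"
  assumes cont: "l \<le> N \<Longrightarrow> continuous_on UNIV (f l)"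
    and deriv: "l < N \<Longrightarrow>
      ((\<lambda>t. f l (x + t *\<^sub>R axis i 1)) has_vector_derivative f (Suc l) x) (at 0)"
    and bounded: "l \<le> N \<Longrightarrow> \<exists>M. \<forall>x. norm (f l x * of_real (hermite \<xi> x)) \<le> M"
begin

text \<open>Apart from \<open>l\<close>, the integrals of the theorem differ only in the
  dependence on \<open>x\<^sub>i\<close>, which \<open>w\<close> collects: it is a product of two
  one-dimensional Hermite functions, or a combination of derivatives of such products.\<close>
definition weighted :: "nat \<Rightarrow> (real \<Rightarrow> real) \<Rightarrow> real ^ 'n \<Rightarrow> complex" where
  "weighted l w x = f l x * of_real (hermite_cofactor i \<xi> x * hermite_cofactor i \<eta> x * w (x $ i))"

lemma weighted_add: "weighted l (\<lambda>t. v t + w t) x = weighted l v x + weighted l w x"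
  and weighted_diff: "weighted l (\<lambda>t. v t - w t) x = weighted l v x - weighted l w x"
  and weighted_cmult: "weighted l (\<lambda>t. c * w t) x = of_real c * weighted l w x"
  by (simp_all add: weighted_def algebra_simps)

lemma continuous_on_weighted:
  assumes "l \<le> N"
  shows "continuous_on UNIV (weighted l (gauss_poly r))"
  unfolding weighted_def[abs_def]
  by (intro continuous_intros cont[OF assms] continuous_on_hermite_cofactor)

text \<open>If the polynomial contains the factor of \<open>h\<^sub>\<xi>\<close> in
  \<open>x\<^sub>i\<close>, then \<open>h\<^sub>\<xi>\<close> can be split off completely, and
  what is left besides a bounded function is an integrable product.\<close>
lemma integrable_weighted_multiple:
  assumes "l \<le> N"
  shows "weighted l (gauss_poly (herm_poly (\<xi> $ i) * q)) integrable_on UNIV"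
proof (rule integrable_on_lborel)
  obtain M where M: "\<And>x. norm (f l x * of_real (hermite \<xi> x)) \<le> M" using bounded[OF assms] by blast
  define c where "c = hermite_norm (\<xi> $ i)"
  have "0 < c" by (simp add: c_def hermite_norm_pos)
  define k where "k = (\<lambda>j t. if j = i then \<bar>poly q t * exp (- (1/2 * t\<^sup>2))\<bar> else \<bar>hermite_fun (\<eta> $ j) t\<bar>)"
  have "integrable lborel (hermite_fun n)" for n
    unfolding hermite_fun_eq[abs_def] by (intro integrable_mult_right integrable_poly_gauss)
  then have "integrable lborel (k j)" for j
    using integrable_poly_gauss[of q] by (cases "j = i") (auto simp: k_def)
  then have "has_bochner_integral lborel (\<lambda>x :: real ^ 'n. \<Prod>j\<in>UNIV. k j (x $ j))
      (\<Prod>j\<in>UNIV. integral\<^sup>L lborel (k j))"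
    by (rule has_bochner_integral_vec_prod) (simp add: k_def)
  then have int: "integrable lborel (\<lambda>x :: real ^ 'n. M / c * (\<Prod>j\<in>UNIV. k j (x $ j)))"
    by (auto simp: has_bochner_integral_iff)
  have prod_k: "(\<Prod>j\<in>UNIV. k j (x $ j)) =
      \<bar>poly q (x $ i) * exp (- (1/2 * (x $ i)\<^sup>2))\<bar> * \<bar>hermite_cofactor i \<eta> x\<bar>" for x
    unfolding hermite_cofactor_def abs_prod
    by (subst prod.remove[of _ i]) (auto simp: k_def intro!: prod.cong)
  show "integrable lborel (weighted l (gauss_poly (herm_poly (\<xi> $ i) * q)))"
  proof (rule Bochner_Integration.integrable_bound[OF int])
    show "weighted l (gauss_poly (herm_poly (\<xi> $ i) * q)) \<in> borel_measurable lborel"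
      using borel_measurable_continuous_onI[OF continuous_on_weighted[OF assms]] by simp
    have "norm (weighted l (gauss_poly (herm_poly (\<xi> $ i) * q)) x) \<le> M / c * (\<Prod>j\<in>UNIV. k j (x $ j))" for x
    proof -
      have "exp (- (x $ i)\<^sup>2) = exp (- (1/2 * (x $ i)\<^sup>2)) * exp (- (1/2 * (x $ i)\<^sup>2))"
        by (simp flip: exp_add)
      then have "weighted l (gauss_poly (herm_poly (\<xi> $ i) * q)) x =
          (f l x * of_real (hermite \<xi> x)) *
          of_real (poly q (x $ i) * exp (- (1/2 * (x $ i)\<^sup>2)) * hermite_cofactor i \<eta> x / c)"
        using \<open>0 < c\<close>
        by (simp add: weighted_def gauss_poly_def hermite_eq_cofactor[of \<xi> x i] hermite_fun_eq c_def[symmetric])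
      also have "norm \<dots> \<le> M * norm (poly q (x $ i) * exp (- (1/2 * (x $ i)\<^sup>2)) * hermite_cofactor i \<eta> x / c)"
        unfolding norm_mult[of "f l x * of_real (hermite \<xi> x)"] norm_of_real
        by (intro mult_mono M order_trans[OF norm_ge_zero M]) auto
      finally show ?thesis unfolding prod_k using \<open>0 < c\<close> by (simp add: abs_mult)
    qed
    then show "AE x in lborel. norm (weighted l (gauss_poly (herm_poly (\<xi> $ i) * q)) x)
        \<le> norm (M / c * (\<Prod>j\<in>UNIV. k j (x $ j)))"
      by (intro AE_I2) (metis abs_ge_self order_trans real_norm_def)
  qed
qed

text \<open>The integrand is the derivative of \<open>weighted l (gauss_poly r)\<close> in the
  direction \<open>i\<close>. That function need not be bounded near the zeros of
  \<open>h\<^sub>\<xi>\<close>, but only its size for large \<open>\<bar>x\<^sub>i\<bar>\<close>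
  matters, and there it is bounded by \<open>f l x * h\<^sub>\<xi>\<close> times the quotient of
  \<open>gauss_poly r\<close> and the \<open>i\<close>-th factor of \<open>h\<^sub>\<xi>\<close>,
  which tends to zero, times the cofactor of \<open>\<eta>\<close>.\<close>
lemma has_integral_weighted_derivative:
  assumes "l < N"
  shows "((\<lambda>x. weighted (Suc l) (gauss_poly r) x + weighted l (gauss_poly (gauss_deriv r)) x)
           has_integral 0) UNIV"
proof (rule has_integral_partial_derivative_zero)
  have l: "l \<le> N" "Suc l \<le> N" using assms by auto
  show "continuous_on UNIV (weighted l (gauss_poly r))" by (rule continuous_on_weighted[OF l(1)])
  show "continuous_on UNIV
      (\<lambda>x. weighted (Suc l) (gauss_poly r) x + weighted l (gauss_poly (gauss_deriv r)) x)"
    by (intro continuous_on_add continuous_on_weighted l)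
  show "((\<lambda>t. weighted l (gauss_poly r) (x + t *\<^sub>R axis i 1)) has_vector_derivative
      weighted (Suc l) (gauss_poly r) x + weighted l (gauss_poly (gauss_deriv r)) x) (at 0)" for x
  proof -
    define c where "c = hermite_cofactor i \<xi> x * hermite_cofactor i \<eta> x"
    have "((\<lambda>t. gauss_poly r (x $ i + t)) has_real_derivative gauss_poly (gauss_deriv r) (x $ i)) (at 0)"
      using gauss_poly_deriv[of r "x $ i"] DERIV_shift[of "gauss_poly r" _ 0 "x $ i"]
      by (simp add: add.commute)
    then have "((\<lambda>t. c * gauss_poly r (x $ i + t)) has_real_derivative
        c * gauss_poly (gauss_deriv r) (x $ i)) (at 0)"
      by (rule DERIV_cmult)
    then have "((\<lambda>t. complex_of_real (c * gauss_poly r (x $ i + t))) has_vector_derivative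
        of_real (c * gauss_poly (gauss_deriv r) (x $ i))) (at 0)"
      by (rule has_vector_derivative_of_real)
    from has_vector_derivative_mult[OF deriv[OF assms, of x] this]
    show ?thesis
      by (simp add: weighted_def hermite_cofactor_translate c_def algebra_simps)
  qed
  show "integrable lborel (\<lambda>t. \<bar>hermite_fun (\<eta> $ j) t\<bar>)" for j
    unfolding hermite_fun_eq by (intro integrable_abs integrable_mult_right integrable_poly_gauss)
  fix \<epsilon> :: real assume "0 < \<epsilon>"
  obtain M where M: "\<And>x. norm (f l x * of_real (hermite \<xi> x)) \<le> M" using bounded[OF l(1)] by blast
  have "0 \<le> M" using order_trans[OF norm_ge_zero M] .
  define \<phi> where "\<phi> = (\<lambda>t. gauss_poly r t / hermite_fun (\<xi> $ i) t)"
  obtain \<delta> where "0 < \<delta>" and \<delta>: "\<forall>\<^sub>F t in at_infinity. \<delta> \<le> \<bar>poly (herm_poly (\<xi> $ i)) t\<bar>"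
    using poly_bounded_below_at_infinity[OF herm_nonzero] by blast
  have "\<forall>\<^sub>F t in at_infinity. norm (\<phi> t) < \<epsilon> / (M + 1)"
    using tendstoD[OF gauss_poly_over_hermite_tendsto_0[of r "\<xi> $ i"], of "\<epsilon> / (M + 1)"]
      \<open>0 < \<epsilon>\<close> \<open>0 \<le> M\<close> by (simp add: \<phi>_def)
  with \<delta> have "\<forall>\<^sub>F t in at_infinity. norm (\<phi> t) < \<epsilon> / (M + 1) \<and> hermite_fun (\<xi> $ i) t \<noteq> 0"
  proof eventually_elim
    case (elim t)
    then show ?case using \<open>0 < \<delta>\<close> hermite_norm_pos[of "\<xi> $ i"] by (auto simp: hermite_fun_eq)
  qed
  then obtain B where B: "\<And>t. B \<le> \<bar>t\<bar> \<Longrightarrow> norm (\<phi> t) < \<epsilon> / (M + 1) \<and> hermite_fun (\<xi> $ i) t \<noteq> 0"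
    unfolding eventually_at_infinity by auto
  show "\<exists>B. \<forall>x. B \<le> \<bar>x $ i\<bar> \<longrightarrow>
      norm (weighted l (gauss_poly r) x) \<le> \<epsilon> * (\<Prod>j\<in>UNIV - {i}. \<bar>hermite_fun (\<eta> $ j) (x $ j)\<bar>)"
  proof (intro exI allI impI)
    fix x :: "real ^ 'n" assume "B \<le> \<bar>x $ i\<bar>"
    note Bx = B[OF this]
    have "weighted l (gauss_poly r) x =
        (f l x * of_real (hermite \<xi> x)) * of_real (\<phi> (x $ i)) * of_real (hermite_cofactor i \<eta> x)"
      using Bx by (simp add: weighted_def \<phi>_def hermite_eq_cofactor[of \<xi> x i])
    then have "norm (weighted l (gauss_poly r) x) =
        norm (f l x * of_real (hermite \<xi> x)) * norm (\<phi> (x $ i)) * \<bar>hermite_cofactor i \<eta> x\<bar>"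
      by (simp only: norm_mult norm_of_real real_norm_def)
    also have "\<dots> \<le> (M + 1) * (\<epsilon> / (M + 1)) * \<bar>hermite_cofactor i \<eta> x\<bar>"
      using M[of x] Bx \<open>0 \<le> M\<close> by (intro mult_right_mono mult_mono) auto
    also have "\<dots> = \<epsilon> * (\<Prod>j\<in>UNIV - {i}. \<bar>hermite_fun (\<eta> $ j) (x $ j)\<bar>)"
      using \<open>0 \<le> M\<close> by (simp add: hermite_cofactor_def abs_prod)
    finally show "norm (weighted l (gauss_poly r) x)
        \<le> \<epsilon> * (\<Prod>j\<in>UNIV - {i}. \<bar>hermite_fun (\<eta> $ j) (x $ j)\<bar>)" .
  qed
qed simp

text \<open>By coprimality of \<open>p\<close> and \<open>p'\<close> every polynomial is \<open>r
  = p a r + p' q\<close>, and \<open>p' q\<close> differs from \<open>gauss_deriv (p q)\<close> by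
  a multiple of \<open>p\<close>. Integration by parts turns \<open>gauss_deriv (p q)\<close> into
  \<open>p q\<close> at the price of one more derivative of the function, which exists because
  \<open>l < N\<close>.\<close>
lemma integrable_weighted_lower:
  assumes "l < N"
  shows "weighted l (gauss_poly r) integrable_on UNIV"
proof -
  let ?p = "herm_poly (\<xi> $ i)"
  obtain a b where ab: "?p * a + pderiv ?p * b = 1" using herm_bezout by blast
  define q where "q = b * r"
  have "r = (?p * a + pderiv ?p * b) * r" by (simp add: ab)
  also have "\<dots> = ?p * (a * r - gauss_deriv q) + gauss_deriv (?p * q)"
    by (simp add: gauss_deriv_def q_def pderiv_mult algebra_simps)
  finally have r: "r = ?p * (a * r - gauss_deriv q) + gauss_deriv (?p * q)" .
  have "(\<lambda>x. (weighted (Suc l) (gauss_poly (?p * q)) x + weighted l (gauss_poly (gauss_deriv (?p * q))) x)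
      - weighted (Suc l) (gauss_poly (?p * q)) x) integrable_on UNIV"
    using assms by (intro integrable_diff has_integral_integrable[OF has_integral_weighted_derivative]
        integrable_weighted_multiple) auto
  then have "weighted l (gauss_poly (gauss_deriv (?p * q))) integrable_on UNIV" by simp
  then have "(\<lambda>x. weighted l (gauss_poly (?p * (a * r - gauss_deriv q))) x
      + weighted l (gauss_poly (gauss_deriv (?p * q))) x) integrable_on UNIV"
    using assms by (intro integrable_add integrable_weighted_multiple) auto
  then show ?thesis
    by (subst r) (simp add: gauss_poly_add weighted_add[abs_def])
qed

text \<open>At the top order one derivative is moved onto the polynomial, which leads back to
  order \<open>N - 1\<close>.\<close>
lemma integrable_weighted:
  assumes "l \<le> N" "1 \<le> N"
  shows "weighted l (gauss_poly r) integrable_on UNIV"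
proof (cases "l < N")
  case True
  then show ?thesis by (rule integrable_weighted_lower)
next
  case False
  with assms obtain m where l: "l = Suc m" and m: "m < N" by (cases l) auto
  have "(\<lambda>x. (weighted (Suc m) (gauss_poly r) x + weighted m (gauss_poly (gauss_deriv r)) x)
      - weighted m (gauss_poly (gauss_deriv r)) x) integrable_on UNIV"
    using m by (intro integrable_diff has_integral_integrable[OF has_integral_weighted_derivative]
        integrable_weighted_lower)
  then show ?thesis by (simp add: l)
qed

lemma integral_weighted_by_parts:
  assumes "l < N" and w: "\<And>t. w t = gauss_poly r t" and w': "\<And>t. (w has_real_derivative w' t) (at t)"
  shows "integral UNIV (weighted (Suc l) w) = - integral UNIV (weighted l w')"
proof -
  have "w = gauss_poly r" using w by blast
  then have "w' t = gauss_poly (gauss_deriv r) t" for t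
    using DERIV_unique[OF w'] gauss_poly_deriv by blast
  then have "w' = gauss_poly (gauss_deriv r)" by blast
  have "integral UNIV (weighted (Suc l) w) + integral UNIV (weighted l w') =
      integral UNIV (\<lambda>x. weighted (Suc l) w x + weighted l w' x)"
    unfolding \<open>w = _\<close> \<open>w' = _\<close> using assms(1)
    by (intro integral_add[symmetric] integrable_weighted) auto
  also have "\<dots> = 0"
    unfolding \<open>w = _\<close> \<open>w' = _\<close> by (intro integral_unique has_integral_weighted_derivative assms(1))
  finally show ?thesis by (simp add: eq_neg_iff_add_eq_0)
qed

definition pairing :: "nat \<Rightarrow> int \<Rightarrow> int \<Rightarrow> complex" where
  "pairing l m n = integral UNIV (weighted l (\<lambda>t. hermite_ext m t * hermite_ext n t))"

lemma integrable_pairing: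
  assumes "l \<le> N" "1 \<le> N"
  shows "weighted l (\<lambda>t. hermite_ext m t * hermite_ext n t) integrable_on UNIV"
proof -
  obtain r where "\<And>t. hermite_ext m t * hermite_ext n t = gauss_poly r t"
    using hermite_ext_mult_gauss_poly by blast
  then have "(\<lambda>t. hermite_ext m t * hermite_ext n t) = gauss_poly r" by blast
  then show ?thesis using integrable_weighted[OF assms] by simp
qed

text \<open>Integration by parts against the Wronskian. Splitting the result into its four terms
  uses that each of them converges separately.\<close>
lemma pairing_recurrence:
  assumes "l < N"
  shows "of_real (2 * real_of_int (m - n)) * pairing l m n =
      of_real (sqrt (real_of_int m / 2)) * pairing (Suc l) (m - 1) n
    - of_real (sqrt (real_of_int (m + 1) / 2)) * pairing (Suc l) (m + 1) n
    - of_real (sqrt (real_of_int n / 2)) * pairing (Suc l) m (n - 1)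
    + of_real (sqrt (real_of_int (n + 1) / 2)) * pairing (Suc l) m (n + 1)"
proof -
  define h where "h = (\<lambda>m n t. hermite_ext m t * hermite_ext n t)"
  define W where "W = (\<lambda>t. sqrt (real_of_int m / 2) * h (m - 1) n t
      - sqrt (real_of_int (m + 1) / 2) * h (m + 1) n t
      - sqrt (real_of_int n / 2) * h m (n - 1) t
      + sqrt (real_of_int (n + 1) / 2) * h m (n + 1) t)"
  have W: "wronskian m n = W"
    by (simp add: fun_eq_iff wronskian_def W_def h_def hermite_deriv_def algebra_simps)
  have ex: "\<exists>r. \<forall>t. h m n t = gauss_poly r t" for m n
    unfolding h_def by (rule hermite_ext_mult_gauss_poly)
  obtain r1 where r1: "\<And>t. h (m - 1) n t = gauss_poly r1 t" using ex by blast
  obtain r2 where r2: "\<And>t. h (m + 1) n t = gauss_poly r2 t" using ex by blast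
  obtain r3 where r3: "\<And>t. h m (n - 1) t = gauss_poly r3 t" using ex by blast
  obtain r4 where r4: "\<And>t. h m (n + 1) t = gauss_poly r4 t" using ex by blast
  have "wronskian m n t = gauss_poly (smult (sqrt (real_of_int m / 2)) r1
      - smult (sqrt (real_of_int (m + 1) / 2)) r2 - smult (sqrt (real_of_int n / 2)) r3
      + smult (sqrt (real_of_int (n + 1) / 2)) r4) t" for t
    unfolding W W_def r1 r2 r3 r4 by (simp add: gauss_poly_def algebra_simps)
  from integral_weighted_by_parts[OF assms this wronskian_deriv]
  have "integral UNIV (weighted (Suc l) W) =
      - integral UNIV (weighted l (\<lambda>t. 2 * real_of_int (n - m) * h m n t))"
    by (simp add: W h_def)
  also have "\<dots> = of_real (2 * real_of_int (m - n)) * pairing l m n"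
    unfolding weighted_cmult[abs_def] pairing_def h_def[symmetric]
    by (subst integral_mult_right) (simp add: h_def algebra_simps)
  finally have "of_real (2 * real_of_int (m - n)) * pairing l m n = integral UNIV (weighted (Suc l) W)" ..
  also have "weighted (Suc l) W = (\<lambda>x.
      of_real (sqrt (real_of_int m / 2)) * weighted (Suc l) (h (m - 1) n) x
      - of_real (sqrt (real_of_int (m + 1) / 2)) * weighted (Suc l) (h (m + 1) n) x
      - of_real (sqrt (real_of_int n / 2)) * weighted (Suc l) (h m (n - 1)) x
      + of_real (sqrt (real_of_int (n + 1) / 2)) * weighted (Suc l) (h m (n + 1)) x)"
    unfolding W_def weighted_add[abs_def] weighted_diff[abs_def] weighted_cmult[abs_def] ..
  also have "integral UNIV \<dots> =
      of_real (sqrt (real_of_int m / 2)) * pairing (Suc l) (m - 1) n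
    - of_real (sqrt (real_of_int (m + 1) / 2)) * pairing (Suc l) (m + 1) n
    - of_real (sqrt (real_of_int n / 2)) * pairing (Suc l) m (n - 1)
    + of_real (sqrt (real_of_int (n + 1) / 2)) * pairing (Suc l) m (n + 1)"
  proof -
    have int: "(\<lambda>x. c * weighted (Suc l) (h m n) x) integrable_on UNIV" for c m n
      unfolding h_def using assms by (intro integrable_on_mult_right integrable_pairing) auto
    have eq: "integral UNIV (\<lambda>x. c * weighted (Suc l) (h m n) x) = c * pairing (Suc l) m n" for c m n
      by (simp add: pairing_def h_def)
    show ?thesis
      by (subst integral_add integral_diff; (intro integrable_diff int)?)+ (simp only: eq)
  qed
  finally show ?thesis .
qed

text \<open>The recurrence with \<open>m = a + \<alpha>\<close> and \<open>n = b + \<beta>\<close>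
  makes \<open>pairing\<close> a quantity that spreads along the walk.\<close>
lemma pairing_expansion:
  assumes "1 \<le> N"
  shows "of_real (2 * real_of_int (int a - int b)) ^ N * pairing 0 (int a) (int b) =
    (\<Sum>(\<alpha>, \<beta>, l)\<in>walk_supp (move_weight a b) moves N.
       of_real (hermite_coeff N a b (\<alpha>, \<beta>, l)) * pairing (nat l) (int a + \<alpha>) (int b + \<beta>))"
proof -
  define T where "T = (\<lambda>(\<alpha>, \<beta>, l). pairing (nat l) (int a + \<alpha>) (int b + \<beta>))"
  have step: "of_real (2 * real_of_int (int a - int b)) * T x =
      (\<Sum>d\<in>moves. of_real (move_weight a b x d) * T (x + d))"
    if "M < N" "x \<in> walk_supp (move_weight a b) moves M" for M x
  proof -
    obtain \<alpha> \<beta> l where x: "x = (\<alpha>, \<beta>, l)" by (cases x)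
    with that hermite_supp_cone have l: "0 \<le> l" "nat l < N" by fastforce+
    have Suc_l: "nat (l + 1) = Suc (nat l)" "nat (1 + l) = Suc (nat l)" using l by simp_all
    have "of_real (2 * real_of_int (int a - int b)) * T x =
        of_real (2 * real_of_int ((int a + \<alpha>) - (int b + \<beta>))) * T x + of_real (2 * real_of_int (\<beta> - \<alpha>)) * T x"
      by (simp add: algebra_simps)
    also have "\<dots> = (\<Sum>d\<in>moves. of_real (move_weight a b x d) * T (x + d))"
      unfolding x T_def prod.case pairing_recurrence[OF l(2)] moves_def
      by (simp add: Suc_l algebra_simps)
    finally show ?thesis .
  qed
  from walk_coeff_sum[OF finite_moves step, of N]
  show ?thesis
    by (simp add: T_def hermite_coeff_def zero_prod_def split_beta)
qed

end

section \<open>Iterated partial derivatives in one direction\<close>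

lemma C_class_partial_iterate:
  "C_class (l + k) f \<Longrightarrow> C_class k ((partial i ^^ l) f)"
  by (induction l arbitrary: k) (force simp flip: add_Suc_right)+

lemma C_class_continuous_on: "C_class k f \<Longrightarrow> continuous_on UNIV f"
  by (cases k) auto

lemma count_list_replicate: "count_list (replicate n a) j = (if j = a then n else 0)"
  by (induction n) auto

text \<open>For a multi-index concentrated in one coordinate there is only one order of
  differentiation, so the arbitrary choice in the definition is determined.\<close>
lemma multi_partial_axis: "multi_partial (axis i l) f = (partial i ^^ l) f"
proof -
  have "js = replicate l i" if "\<forall>j. count_list js j = (axis i l :: nat ^ 'a) $ j" for js
  proof -
    have "set js \<subseteq> {i}"
      using that by (auto simp: axis_def count_list_0_iff split: if_splits)
    then have "js = replicate (length js) i" by (intro replicate_eqI) auto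
    moreover have "count_list js i = l" using that by simp
    ultimately show ?thesis by (metis count_list_replicate)
  qed
  then have "(SOME js. \<forall>j. count_list js j = (axis i l :: nat ^ 'a) $ j) = replicate l i"
    by (intro some_equality) (simp add: axis_def count_list_replicate)
  then show ?thesis by (simp add: multi_partial_def foldr_replicate)
qed

lemma bounded_if_vanishing_at_infinity:
  fixes \<phi> :: "'a::euclidean_space \<Rightarrow> 'b::real_normed_vector"
  assumes "continuous_on UNIV \<phi>" and "((\<lambda>x. norm (\<phi> x)) \<longlongrightarrow> 0) at_infinity"
  shows "\<exists>M. \<forall>x. norm (\<phi> x) \<le> M"
proof -
  have "\<forall>\<^sub>F x in at_infinity. norm (\<phi> x) < 1"
    using order_tendstoD(2)[OF assms(2)] by simp
  then obtain b where b: "\<And>x. b \<le> norm x \<Longrightarrow> norm (\<phi> x) < 1"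
    unfolding eventually_at_infinity by blast
  have "compact (\<phi> ` cball 0 b)"
    by (intro compact_continuous_image continuous_on_subset[OF assms(1)]) auto
  then obtain M where "\<And>y. y \<in> \<phi> ` cball 0 b \<Longrightarrow> norm y \<le> M"
    using compact_imp_bounded bounded_iff by metis
  then have "norm (\<phi> x) \<le> max M 1" for x
    using b[of x] by (cases "norm x \<le> b") (auto simp: le_max_iff_disj)
  then show ?thesis by blast
qed

lemma hermite_weighted_derivatives_partial:
  assumes C: "C_class N f"
    and decay: "\<And>\<gamma>. multi_order \<gamma> \<le> N \<Longrightarrow>
      ((\<lambda>x. cmod (multi_partial \<gamma> f x * of_real (hermite \<xi> x))) \<longlongrightarrow> 0) at_infinity"
  shows "hermite_weighted_derivatives (\<lambda>l. (partial i ^^ l) f) N i \<xi>"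
proof
  show cont: "continuous_on UNIV ((partial i ^^ l) f)" if "l \<le> N" for l
    using C_class_partial_iterate[of l "N - l" f i] C that by (auto intro: C_class_continuous_on)
  show "((\<lambda>t. (partial i ^^ l) f (x + t *\<^sub>R axis i 1)) has_vector_derivative
      (partial i ^^ Suc l) f x) (at 0)" if "l < N" for l x
  proof -
    have "C_class (Suc (N - Suc l)) ((partial i ^^ l) f)"
      using C that by (intro C_class_partial_iterate) simp
    then show ?thesis
      by (simp add: partial_differentiable_def partial_def vector_derivative_works)
  qed
  show "\<exists>M. \<forall>x. norm ((partial i ^^ l) f x * of_real (hermite \<xi> x)) \<le> M" if "l \<le> N" for l
  proof (rule bounded_if_vanishing_at_infinity)
    show "continuous_on UNIV (\<lambda>x. (partial i ^^ l) f x * complex_of_real (hermite \<xi> x))"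
      unfolding hermite_eq_cofactor[of \<xi> _ i]
      by (intro continuous_intros cont[OF that] continuous_on_hermite_cofactor)
    have "multi_order (axis i l) \<le> N"
      using that by (simp add: multi_order_def axis_def)
    from decay[OF this] show "((\<lambda>x. norm ((partial i ^^ l) f x * complex_of_real (hermite \<xi> x))) \<longlongrightarrow> 0) at_infinity"
      by (simp add: multi_partial_axis)
  qed
qed

section \<open>The expansion\<close>

text \<open>Both the number of nonzero terms and the passage from the sum over walks to the sum
  over \<open>sum_index N\<close> follow from this identification; \<open>\<bar>\<alpha> -
  \<beta>\<bar> \<le> N\<close> comes from \<open>\<bar>\<alpha>\<bar> + \<bar>\<beta>\<bar> \<le>
  l\<close>.\<close>
lemma hermite_supp_sum_index:
  assumes "1 \<le> N"
  shows "walk_supp (move_weight a b) moves N =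
    (\<lambda>(\<alpha>, \<beta>, l). (\<alpha>, \<beta>, int l)) ` {(\<alpha>, \<beta>, l) \<in> sum_index N. hermite_coeff N a b (\<alpha>, \<beta>, int l) \<noteq> 0}"
    (is "?W = ?f ` ?S")
proof (intro subset_antisym subsetI)
  fix y assume y: "y \<in> ?W"
  obtain \<alpha> \<beta> l where eq: "y = (\<alpha>, \<beta>, l)" by (cases y)
  have "\<bar>\<alpha>\<bar> + \<bar>\<beta>\<bar> \<le> l \<and> l \<le> int N" "1 \<le> l"
    using hermite_supp_cone hermite_supp_pos[OF _ assms] y eq by blast+
  then have "(\<alpha>, \<beta>, nat l) \<in> ?S" "y = ?f (\<alpha>, \<beta>, nat l)"
    using y by (auto simp: eq sum_index_def hermite_coeff_def walk_supp_def)
  then show "y \<in> ?f ` ?S" by blast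
next
  fix y assume "y \<in> ?f ` ?S"
  then show "y \<in> ?W" by (auto simp: walk_supp_def hermite_coeff_def)
qed

theorem proposition2p3:
  "\<exists>(C :: nat \<Rightarrow> nat \<Rightarrow> nat \<Rightarrow> int \<Rightarrow> int \<Rightarrow> nat \<Rightarrow> real) (c :: nat \<Rightarrow> real). \<forall>N\<ge>1.
     (\<forall>a b. \<forall>(\<alpha>, \<beta>, l)\<in>sum_index N.
        \<bar>C N a b \<alpha> \<beta> l\<bar> \<le> c N * bracket (real (max a b)) powr (real N / 2)) \<and>
     (\<forall>a b. card {(\<alpha>, \<beta>, l)\<in>sum_index N. C N a b \<alpha> \<beta> l \<noteq> 0} \<le> 5 ^ N) \<and>
     (\<forall>g :: real ^ 'n \<Rightarrow> nat ^ 'n \<Rightarrow> nat ^ 'n \<Rightarrow> complex.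
        (\<forall>\<xi> \<eta>. C_class N (\<lambda>x. g x \<xi> \<eta>)) \<longrightarrow>
        (\<forall>\<gamma> \<xi> \<eta>. multi_order \<gamma> \<le> N \<longrightarrow>
           ((\<lambda>x. cmod (multi_partial \<gamma> (\<lambda>y. g y \<xi> \<eta>) x * of_real (hermite \<xi> x))) \<longlongrightarrow> 0)
             at_infinity) \<longrightarrow>
        (\<forall>i \<xi> \<eta>.
           2 ^ N * of_int (int (\<xi> $ i) - int (\<eta> $ i)) ^ N * G_int g \<xi> \<eta> =
             (\<Sum>(\<alpha>, \<beta>, l)\<in>sum_index N. of_real (C N (\<xi> $ i) (\<eta> $ i) \<alpha> \<beta> l) *
                integral UNIV (term_integrand g i \<xi> \<eta> \<alpha> \<beta> l))))"
proof (intro exI[of _ "\<lambda>N a b \<alpha> \<beta> l. hermite_coeff N a b (\<alpha>, \<beta>, int l)"]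
    exI[of _ "\<lambda>N. (10 * real (Suc N)) ^ N"] allI impI conjI)
  fix N a b :: nat
  show "\<forall>(\<alpha>, \<beta>, l)\<in>sum_index N. \<bar>hermite_coeff N a b (\<alpha>, \<beta>, int l)\<bar>
      \<le> (10 * real (Suc N)) ^ N * bracket (real (max a b)) powr (real N / 2)"
    using abs_hermite_coeff_le by blast
next
  fix N a b :: nat assume "1 \<le> N"
  have "inj_on (\<lambda>(\<alpha>, \<beta>, l). (\<alpha>, \<beta>, int l)) S" for S :: "(int \<times> int \<times> nat) set"
    by (auto simp: inj_on_def)
  then show "card {(\<alpha>, \<beta>, l)\<in>sum_index N. hermite_coeff N a b (\<alpha>, \<beta>, int l) \<noteq> 0} \<le> 5 ^ N"
    using card_walk_supp[OF finite_moves, of "move_weight a b" N]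
    by (simp add: hermite_supp_sum_index[OF \<open>1 \<le> N\<close>] card_image card_moves)
next
  fix N :: nat and g :: "real ^ 'n \<Rightarrow> nat ^ 'n \<Rightarrow> nat ^ 'n \<Rightarrow> complex" and i and \<xi> \<eta> :: "nat ^ 'n"
  assume "1 \<le> N" and C: "\<forall>\<xi> \<eta>. C_class N (\<lambda>x. g x \<xi> \<eta>)"
    and decay: "\<forall>\<gamma> \<xi> \<eta>. multi_order \<gamma> \<le> N \<longrightarrow>
      ((\<lambda>x. cmod (multi_partial \<gamma> (\<lambda>y. g y \<xi> \<eta>) x * of_real (hermite \<xi> x))) \<longlongrightarrow> 0) at_infinity"
  interpret hermite_weighted_derivatives "\<lambda>l. (partial i ^^ l) (\<lambda>x. g x \<xi> \<eta>)" N i \<xi> \<eta>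
    using C decay by (intro hermite_weighted_derivatives_partial) auto
  define a b where "a = \<xi> $ i" and "b = \<eta> $ i"
  have G: "G_int g \<xi> \<eta> = pairing 0 (int a) (int b)"
    unfolding G_int_def pairing_def weighted_def[abs_def] hermite_eq_cofactor[of _ _ i] a_def b_def
    by (simp add: hermite_ext_def mult_ac)
  have T: "integral UNIV (term_integrand g i \<xi> \<eta> \<alpha> \<beta> l) = pairing l (int a + \<alpha>) (int b + \<beta>)" for \<alpha> \<beta> l
    unfolding pairing_def weighted_def[abs_def] term_integrand_def[abs_def] hermite_int_shift a_def b_def
    by (simp add: mult_ac)
  let ?S = "{(\<alpha>, \<beta>, l) \<in> sum_index N. hermite_coeff N a b (\<alpha>, \<beta>, int l) \<noteq> 0}"
  have fin: "finite (sum_index N)"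
    by (rule finite_subset[of _ "{- int N..int N} \<times> {- int N..int N} \<times> {1..N}"]) (auto simp: sum_index_def)
  have "2 ^ N * of_int (int a - int b) ^ N * G_int g \<xi> \<eta> =
      of_real (2 * real_of_int (int a - int b)) ^ N * pairing 0 (int a) (int b)"
    by (simp add: G flip: power_mult_distrib)
  also have "\<dots> = (\<Sum>(\<alpha>, \<beta>, l)\<in>?S. of_real (hermite_coeff N a b (\<alpha>, \<beta>, int l)) * pairing l (int a + \<alpha>) (int b + \<beta>))"
    unfolding pairing_expansion[OF \<open>1 \<le> N\<close>] hermite_supp_sum_index[OF \<open>1 \<le> N\<close>]
    by (subst sum.reindex) (auto simp: inj_on_def intro!: sum.cong)
  also have "\<dots> = (\<Sum>(\<alpha>, \<beta>, l)\<in>sum_index N.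
      of_real (hermite_coeff N a b (\<alpha>, \<beta>, int l)) * pairing l (int a + \<alpha>) (int b + \<beta>))"
    by (rule sum.mono_neutral_left[OF fin]) auto
  finally show "2 ^ N * of_int (int (\<xi> $ i) - int (\<eta> $ i)) ^ N * G_int g \<xi> \<eta> =
      (\<Sum>(\<alpha>, \<beta>, l)\<in>sum_index N. of_real (hermite_coeff N (\<xi> $ i) (\<eta> $ i) (\<alpha>, \<beta>, int l)) *
         integral UNIV (term_integrand g i \<xi> \<eta> \<alpha> \<beta> l))"
    unfolding T a_def b_def .
qed

end
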